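(* Let $n\in\mathbb N$ (finite, $n\ge 1$), let $A\in\mathscr V_n(\mathcal H_A)$ and $B\in\mathscr V_n(\mathcal H_B)$, and let $\mathscr H_A$, $\mathscr H_B$ be abstract model spaces for $A$, $B$ (with respect to arbitrary models $\Gamma_A$, $\Gamma_B$), with associated partial isometries $\mathfrak Z_A$ on $\mathscr H_A$ and $\mathfrak Z_B$ on $\mathscr H_B$. Then the following are equivalent: (1) $A\preccurlyeq B$; (2) $\mathfrak Z_A\preccurlyeq\mathfrak Z_B$; (3) there exists an isometric multiplier from $\mathscr H_A$ to $\mathscr H_B$, i.e. an analytic function $R:\mathbb C\setminus\mathbb T\to M_n(\mathbb C)$ such that $Rf\in\mathscr H_B$ and $\|Rf\|_{\mathscr H_B}=\|f\|_{\mathscr H_A}$ for every $f\in\mathscr H_A$.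
   Context: All Hilbert spaces are complex and separable. $\mathbb D$ is the open unit disk, $\mathbb T$ the unit circle. A bounded operator $V$ on $\mathcal H$ is a partial isometry if it is isometric on $\ker(V)^\perp$. It is completely non-unitary if there is no nonzero subspace $\mathcal M$ reducing $V$ such that $V|_{\mathcal M}$ is unitary on $\mathcal M$. $\mathscr V_n(\mathcal H)$ is the set of completely non-unitary partial isometries $V$ on $\mathcal H$ with $\dim\ker(V)=\dim\operatorname{Ran}(V)^\perp=n$. For $V\in\mathscr V_n(\mathcal H)$ and $\lambda\in\mathbb C\setminus\mathbb T$ put $\widetilde{\operatorname{Ran}}(V-\lambda I):=(V-\lambda I)\ker(V)^\perp$; its orthogonal complement has dimension $n$. A model for $V$ is an anti-analytic map $\Gamma:\mathbb C\setminus\mathbb T\to\mathcal B(\mathbb C^n,\mathcal H)$ such that, for each $\lambda$, $\Gamma(\lambda)$ is a linear bijection from $\mathbb C^n$ onto $\widetilde{\operatorname{Ran}}(V-\lambda I)^\perp$. (Models exist: if $U$ is a unitary extension of $V|_{\ker(V)^\perp}$ to $\mathcal H$ and $j:\mathbb C^n\to\operatorname{Ran}(V)^\perp$ is a linear isomorphism, then $\Gamma(\lambda)=(I-\overline\lambda U)^{-1}j$ is one; and since $V$ is completely non-unitary, the ranges of $\Gamma(\lambda)$, $\lambda\in\mathbb C\setminus\mathbb T$, span a dense subspace of $\mathcal H$.) For $f\in\mathcal H$ let $\widehat f(\lambda)=\Gamma(\lambda)^*f$. The abstract model space of $V$ for $\Gamma$ is $\mathscr H_V=\mathscr H_{V,\Gamma}=\{\widehat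 f: f\in\mathcal H\}$ with $\langle\widehat f,\widehat g\rangle:=\langle f,g\rangle$, a Hilbert space of $\mathbb C^n$-valued analytic functions on $\mathbb C\setminus\mathbb T$. $\mathfrak Z_V$ is the partial isometry on $\mathscr H_V$ that acts as $f\mapsto zf$ on the (closed) subspace $\{f\in\mathscr H_V: zf\in\mathscr H_V\}$ and as $0$ on its orthogonal complement; it belongs to $\mathscr V_n(\mathscr H_V)$ and is unitarily equivalent to $V$. For $A\in\mathscr V_n(\mathcal H_A)$, $B\in\mathscr V_n(\mathcal H_B)$, write $A\preccurlyeq B$ if there is a linear isometry $U:\mathcal H_A\to\mathcal H_B$ (not necessarily onto) with $U\ker(A)^\perp\subset\ker(B)^\perp$ and $UA|_{\ker(A)^\perp}=BU|_{\ker(A)^\perp}$. *)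

theory Defs
  imports "HOL-Complex_Analysis.Complex_Analysis" "HOL-Library.Function_Algebras"
begin

section \<open>Complex Hilbert spaces\<close>

text \<open>
  The abstract model spaces are Hilbert spaces whose underlying set and inner product depend on
  parameters, so a Hilbert space is a record rather than a type: a linear subspace \<open>hcarrier\<close> of an
  ambient complex vector space (the whole type, with scalar multiplication \<open>hscale\<close>), together
  with an inner product, of which only the values on the carrier matter.  The inner product is
  linear in its first argument.
\<close>

record 'a hspace =
  hcarrier :: "'a set"
  hscale :: "complex \<Rightarrow> 'a \<Rightarrow> 'a"
  hinner :: "'a \<Rightarrow> 'a \<Rightarrow> complex"

definition hnorm :: "'a hspace \<Rightarrow> 'a \<Rightarrow> real" where
  "hnorm H x = sqrt (Re (hinner H x x))"

text \<open>The guard makes \<open>hdist\<close> symmetric on the whole type, as the locale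
  \<open>Metric_space\<close> demands.\<close>

definition hdist :: "'a::ab_group_add hspace \<Rightarrow> 'a \<Rightarrow> 'a \<Rightarrow> real" where
  "hdist H x y = (if x \<in> hcarrier H \<and> y \<in> hcarrier H then hnorm H (x - y) else 0)"

locale complex_inner_product_space = vector_space "hscale H"
  for H :: "'a::ab_group_add hspace" +
  assumes subspace_hcarrier: "subspace (hcarrier H)"
    and hinner_add: "\<lbrakk>x \<in> hcarrier H; y \<in> hcarrier H; z \<in> hcarrier H\<rbrakk>
          \<Longrightarrow> hinner H (x + y) z = hinner H x z + hinner H y z"
    and hinner_scale: "\<lbrakk>x \<in> hcarrier H; y \<in> hcarrier H\<rbrakk>
          \<Longrightarrow> hinner H (hscale H c x) y = c * hinner H x y"
    and hinner_commute: "\<lbrakk>x \<in> hcarrier H; y \<in> hcarrier H\<rbrakk>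
          \<Longrightarrow> hinner H x y = cnj (hinner H y x)"
    and hinner_nonneg: "x \<in> hcarrier H \<Longrightarrow> 0 \<le> Re (hinner H x x)"
    and hinner_definite: "\<lbrakk>x \<in> hcarrier H; hinner H x x = 0\<rbrakk> \<Longrightarrow> x = 0"
begin

lemma hinner_self: "x \<in> hcarrier H \<Longrightarrow> hinner H x x = of_real ((hnorm H x)\<^sup>2)"
proof -
  assume x: "x \<in> hcarrier H"
  have "Im (hinner H x x) = 0"
    using arg_cong[OF hinner_commute[OF x x], of Im] by simp
  then show ?thesis
    using hinner_nonneg[OF x] by (simp add: hnorm_def complex_eq_iff)
qed

lemma hinner_add_right:
  assumes "x \<in> hcarrier H" "y \<in> hcarrier H" "z \<in> hcarrier H"
  shows "hinner H z (x + y) = hinner H z x + hinner H z y"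
  using assms subspace_add[OF subspace_hcarrier]
  by (metis hinner_add hinner_commute complex_cnj_add)

lemma hinner_scale_right:
  assumes "x \<in> hcarrier H" "y \<in> hcarrier H"
  shows "hinner H y (hscale H c x) = cnj c * hinner H y x"
  using assms subspace_scale[OF subspace_hcarrier]
  by (metis hinner_scale hinner_commute complex_cnj_mult)

lemma hnorm_add_scale_square:
  assumes x: "x \<in> hcarrier H" and y: "y \<in> hcarrier H"
  shows "(hnorm H (x + hscale H c y))\<^sup>2
    = (hnorm H x)\<^sup>2 + 2 * Re (cnj c * hinner H x y) + (cmod c)\<^sup>2 * (hnorm H y)\<^sup>2"
proof -
  have cy: "hscale H c y \<in> hcarrier H"
    using y subspace_scale[OF subspace_hcarrier] by blast
  have s: "x + hscale H c y \<in> hcarrier H"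
    using x cy subspace_add[OF subspace_hcarrier] by blast
  have yx: "hinner H y x = cnj (hinner H x y)"
    using hinner_commute[OF y x] .
  have "hinner H (x + hscale H c y) (x + hscale H c y)
      = hinner H x x + cnj c * hinner H x y + c * cnj (hinner H x y) + c * (cnj c * hinner H y y)"
    using x y cy s by (simp add: hinner_add hinner_add_right hinner_scale hinner_scale_right yx algebra_simps)
  then have "Re (of_real ((hnorm H (x + hscale H c y))\<^sup>2))
      = Re (of_real ((hnorm H x)\<^sup>2) + cnj c * hinner H x y + c * cnj (hinner H x y)
            + c * (cnj c * of_real ((hnorm H y)\<^sup>2)))"
    using hinner_self[OF s] hinner_self[OF x] hinner_self[OF y] by simp
  then show ?thesis
    unfolding cmod_power2 by (simp add: algebra_simps power2_eq_square)
qed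

lemma Cauchy_Schwarz:
  assumes x: "x \<in> hcarrier H" and y: "y \<in> hcarrier H"
  shows "cmod (hinner H x y) \<le> hnorm H x * hnorm H y"
proof (cases "y = 0")
  case True
  have "hinner H x (hscale H 0 y) = 0"
    using hinner_scale_right[OF y x, of 0] by simp
  then show ?thesis
    using True hinner_nonneg[OF x] hinner_nonneg[OF y] by (simp add: hnorm_def)
next
  case False
  define N where "N = (hnorm H y)\<^sup>2"
  define p where "p = hinner H x y"
  have "N \<noteq> 0"
    using False hinner_definite[OF y] hinner_self[OF y] unfolding N_def by auto
  then have N: "N > 0"
    unfolding N_def by simp
  have "0 \<le> (hnorm H x)\<^sup>2 + 2 * Re (cnj (- p / of_real N) * p) + (cmod (- p / of_real N))\<^sup>2 * N"
    using hnorm_add_scale_square[OF x y, of "- p / of_real N"] zero_le_power2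
    unfolding N_def p_def by metis
  also have "Re (cnj (- p / of_real N) * p) = - (cmod p)\<^sup>2 / N"
    using N unfolding cmod_power2 by (simp add: Re_divide_of_real field_simps power2_eq_square)
  also have "(cmod (- p / of_real N))\<^sup>2 * N = (cmod p)\<^sup>2 / N"
    using N by (simp add: norm_divide power_divide power2_eq_square)
  finally have "(cmod p)\<^sup>2 \<le> (hnorm H x * hnorm H y)\<^sup>2"
    using N by (simp add: field_simps N_def)
  then show ?thesis
    unfolding p_def
    by (rule power2_le_imp_le) (simp add: hnorm_def hinner_nonneg x y)
qed

lemma hnorm_triangle:
  assumes x: "x \<in> hcarrier H" and y: "y \<in> hcarrier H"
  shows "hnorm H (x + y) \<le> hnorm H x + hnorm H y"
proof (rule power2_le_imp_le)
  have "Re (hinner H x y) \<le> hnorm H x * hnorm H y"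
    using Cauchy_Schwarz[OF x y] complex_Re_le_cmod order_trans by blast
  then show "(hnorm H (x + y))\<^sup>2 \<le> (hnorm H x + hnorm H y)\<^sup>2"
    using hnorm_add_scale_square[OF x y, of 1] by (simp add: power2_sum)
  show "0 \<le> hnorm H x + hnorm H y"
    by (simp add: hnorm_def hinner_nonneg x y)
qed

lemma Metric_space_hdist: "Metric_space (hcarrier H) (hdist H)"
proof
  have diff: "x - y \<in> hcarrier H" if "x \<in> hcarrier H" "y \<in> hcarrier H" for x y
    using that subspace_diff[OF subspace_hcarrier] by blast
  have minus: "hnorm H (- x) = hnorm H x" if x: "x \<in> hcarrier H" for x
  proof -
    have "- x \<in> hcarrier H"
      using x subspace_neg[OF subspace_hcarrier] by blast
    then show ?thesis
      using x hinner_scale[of x "hscale H (-1) x" "-1"] hinner_scale_right[of x x "-1"]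
      by (simp add: hnorm_def)
  qed
  fix x y z
  show "0 \<le> hdist H x y"
    using diff by (simp add: hdist_def hnorm_def hinner_nonneg)
  show "hdist H x y = hdist H y x"
    using minus[of "x - y"] diff[of x y] by (auto simp: hdist_def)
  assume x: "x \<in> hcarrier H" and y: "y \<in> hcarrier H"
  have "hnorm H 0 = 0"
    using hinner_scale[OF x x, of 0] subspace_0[OF subspace_hcarrier]
      hinner_scale[of 0 0 0] by (simp add: hnorm_def)
  then show "hdist H x y = 0 \<longleftrightarrow> x = y"
    using x y diff[OF x y] hinner_definite[of "x - y"] hinner_self[of "x - y"]
    by (auto simp: hdist_def)
  assume z: "z \<in> hcarrier H"
  show "hdist H x z \<le> hdist H x y + hdist H y z"
    using x y z hnorm_triangle[of "x - y" "y - z"] diff by (simp add: hdist_def)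
qed

end

definition htopology :: "'a::ab_group_add hspace \<Rightarrow> 'a topology" where
  "htopology H = Metric_space.mtopology (hcarrier H) (hdist H)"

locale complex_hilbert_space = complex_inner_product_space H
  for H :: "'a::ab_group_add hspace" +
  assumes complete: "Metric_space.mcomplete (hcarrier H) (hdist H)"
    and separable: "separable_space (htopology H)"

definition orth_compl :: "'a hspace \<Rightarrow> 'a set \<Rightarrow> 'a set" where
  "orth_compl H S = {x \<in> hcarrier H. \<forall>s\<in>S. hinner H x s = 0}"

definition closed_subspace :: "'a::ab_group_add hspace \<Rightarrow> 'a set \<Rightarrow> bool" where
  "closed_subspace H M \<longleftrightarrow>
     M \<subseteq> hcarrier H \<and> module.subspace (hscale H) M \<and> closedin (htopology H) M"

definition orth_proj :: "'a::ab_group_add hspace \<Rightarrow> 'a set \<Rightarrow> 'a \<Rightarrow> 'a" where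
  "orth_proj H M x = (THE y. y \<in> M \<and> x - y \<in> orth_compl H M)"

definition cvec_space :: "(complex ^ 'n) hspace" where
  "cvec_space = \<lparr>hcarrier = UNIV, hscale = (*s), hinner = (\<lambda>x y. \<Sum>i\<in>UNIV. x $ i * cnj (y $ i))\<rparr>"


section \<open>Operators\<close>

text \<open>Operators are functions on the ambient types; their values off the carrier are irrelevant.\<close>

definition hlinear ::
  "'a::ab_group_add hspace \<Rightarrow> 'b::ab_group_add hspace \<Rightarrow> ('a \<Rightarrow> 'b) \<Rightarrow> bool" where
  "hlinear H K T \<longleftrightarrow>
     T ` hcarrier H \<subseteq> hcarrier K \<and>
     (\<forall>x\<in>hcarrier H. \<forall>y\<in>hcarrier H. T (x + y) = T x + T y) \<and>
     (\<forall>c. \<forall>x\<in>hcarrier H. T (hscale H c x) = hscale K c (T x))"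

definition hbounded ::
  "'a::ab_group_add hspace \<Rightarrow> 'b::ab_group_add hspace \<Rightarrow> ('a \<Rightarrow> 'b) \<Rightarrow> bool" where
  "hbounded H K T \<longleftrightarrow>
     hlinear H K T \<and> (\<exists>C. \<forall>x\<in>hcarrier H. hnorm K (T x) \<le> C * hnorm H x)"

definition hisometry ::
  "'a::ab_group_add hspace \<Rightarrow> 'b::ab_group_add hspace \<Rightarrow> ('a \<Rightarrow> 'b) \<Rightarrow> bool" where
  "hisometry H K U \<longleftrightarrow> hlinear H K U \<and> (\<forall>x\<in>hcarrier H. hnorm K (U x) = hnorm H x)"

definition hopnorm :: "'a hspace \<Rightarrow> 'b hspace \<Rightarrow> ('a \<Rightarrow> 'b) \<Rightarrow> real" where
  "hopnorm H K T = (SUP x\<in>{x \<in> hcarrier H. hnorm H x \<le> 1}. hnorm K (T x))"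

definition hadjoint :: "'a hspace \<Rightarrow> 'b hspace \<Rightarrow> ('a \<Rightarrow> 'b) \<Rightarrow> 'b \<Rightarrow> 'a" where
  "hadjoint H K T y =
     (THE x. x \<in> hcarrier H \<and> (\<forall>u\<in>hcarrier H. hinner H x u = hinner K y (T u)))"

definition hker :: "'a::ab_group_add hspace \<Rightarrow> ('a \<Rightarrow> 'a) \<Rightarrow> 'a set" where
  "hker H T = {x \<in> hcarrier H. T x = 0}"

abbreviation hker_perp :: "'a::ab_group_add hspace \<Rightarrow> ('a \<Rightarrow> 'a) \<Rightarrow> 'a set" where
  "hker_perp H T \<equiv> orth_compl H (hker H T)"

definition partial_isometry :: "'a::ab_group_add hspace \<Rightarrow> ('a \<Rightarrow> 'a) \<Rightarrow> bool" where
  "partial_isometry H V \<longleftrightarrow>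
     hbounded H H V \<and> (\<forall>x\<in>hker_perp H V. hnorm H (V x) = hnorm H x)"

definition reduces :: "'a::ab_group_add hspace \<Rightarrow> 'a set \<Rightarrow> ('a \<Rightarrow> 'a) \<Rightarrow> bool" where
  "reduces H M V \<longleftrightarrow>
     closed_subspace H M \<and> V ` M \<subseteq> M \<and> V ` orth_compl H M \<subseteq> orth_compl H M"

definition unitary_on :: "'a hspace \<Rightarrow> 'a set \<Rightarrow> ('a \<Rightarrow> 'a) \<Rightarrow> bool" where
  "unitary_on H M V \<longleftrightarrow>
     V ` M = M \<and> (\<forall>x\<in>M. \<forall>y\<in>M. hinner H (V x) (V y) = hinner H x y)"

definition completely_non_unitary :: "'a::ab_group_add hspace \<Rightarrow> ('a \<Rightarrow> 'a) \<Rightarrow> bool" where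
  "completely_non_unitary H V \<longleftrightarrow> \<not> (\<exists>M. M \<noteq> {0} \<and> reduces H M V \<and> unitary_on H M V)"

text \<open>\<open>vector_space.dim\<close> is \<open>0\<close> for infinite-dimensional spaces, so the
  following is the intended condition only for \<open>n \<ge> 1\<close>, which holds in the use below
  where \<open>n = CARD('n)\<close>.\<close>

definition cnu_partial_isometries :: "nat \<Rightarrow> 'a::ab_group_add hspace \<Rightarrow> ('a \<Rightarrow> 'a) set" where
  "cnu_partial_isometries n H =
     {V. partial_isometry H V \<and> completely_non_unitary H V \<and>
         vector_space.dim (hscale H) (hker H V) = n \<and>
         vector_space.dim (hscale H) (orth_compl H (V ` hcarrier H)) = n}"

definition preceq ::
  "'a::ab_group_add hspace \<Rightarrow> ('a \<Rightarrow> 'a) \<Rightarrow> 'b::ab_group_add hspace \<Rightarrow> ('b \<Rightarrow> 'b) \<Rightarrow> bool" where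
  "preceq HA A HB B \<longleftrightarrow>
     (\<exists>U. hisometry HA HB U \<and> U ` hker_perp HA A \<subseteq> hker_perp HB B \<and>
          (\<forall>x\<in>hker_perp HA A. U (A x) = B (U x)))"


section \<open>Models and abstract model spaces\<close>

text \<open>\<open>F\<close> is anti-analytic on \<open>S\<close> when its difference quotients with respect to the
  conjugate variable converge in operator norm.\<close>

definition anti_analytic_on ::
  "'a::ab_group_add hspace \<Rightarrow> 'b::ab_group_add hspace \<Rightarrow> (complex \<Rightarrow> 'a \<Rightarrow> 'b) \<Rightarrow> complex set \<Rightarrow> bool"
  where
  "anti_analytic_on H K F S \<longleftrightarrow>
     (\<forall>z\<in>S. \<exists>D. hbounded H K D \<and>
        ((\<lambda>w. hopnorm H K (\<lambda>x. hscale K (1 / cnj (w - z)) (F w x - F z x) - D x))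
           \<longlongrightarrow> 0) (at z within S))"

abbreviation off_circle :: "complex set" where
  "off_circle \<equiv> - sphere 0 1"

definition ran_tilde :: "'a::ab_group_add hspace \<Rightarrow> ('a \<Rightarrow> 'a) \<Rightarrow> complex \<Rightarrow> 'a set" where
  "ran_tilde H V z = (\<lambda>x. V x - hscale H z x) ` hker_perp H V"

definition is_model ::
  "'a::ab_group_add hspace \<Rightarrow> ('a \<Rightarrow> 'a) \<Rightarrow> (complex \<Rightarrow> complex ^ 'n \<Rightarrow> 'a) \<Rightarrow> bool" where
  "is_model H V \<Gamma> \<longleftrightarrow>
     anti_analytic_on cvec_space H \<Gamma> off_circle \<and>
     (\<forall>z\<in>off_circle. hbounded cvec_space H (\<Gamma> z) \<and>
        bij_betw (\<Gamma> z) UNIV (orth_compl H (ran_tilde H V z)))"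

text \<open>A function on the complement of the circle is represented by its extension by \<open>0\<close> to the
  plane, so that equality in the function type is equality off the circle.\<close>

definition model_transform ::
  "'a hspace \<Rightarrow> (complex \<Rightarrow> complex ^ 'n \<Rightarrow> 'a) \<Rightarrow> 'a \<Rightarrow> complex \<Rightarrow> complex ^ 'n" where
  "model_transform H \<Gamma> f =
     (\<lambda>z. if z \<in> off_circle then hadjoint cvec_space H (\<Gamma> z) f else 0)"

text \<open>The transform is injective on \<open>hcarrier H\<close> when \<open>\<Gamma>\<close> is a model of a completely
  non-unitary \<open>V\<close>, so the inner product below is the one transported from \<open>H\<close>.\<close>

definition model_space ::
  "'a hspace \<Rightarrow> (complex \<Rightarrow> complex ^ 'n \<Rightarrow> 'a) \<Rightarrow> (complex \<Rightarrow> complex ^ 'n) hspace" where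
  "model_space H \<Gamma> =
     \<lparr>hcarrier = model_transform H \<Gamma> ` hcarrier H,
      hscale = (\<lambda>c f z. c *s f z),
      hinner = (\<lambda>f g. hinner H (the_inv_into (hcarrier H) (model_transform H \<Gamma>) f)
                               (the_inv_into (hcarrier H) (model_transform H \<Gamma>) g))\<rparr>"

definition mult_z :: "(complex \<Rightarrow> complex ^ 'n) \<Rightarrow> complex \<Rightarrow> complex ^ 'n" where
  "mult_z f = (\<lambda>z. z *s f z)"

definition mult_z_dom :: "(complex \<Rightarrow> complex ^ 'n) hspace \<Rightarrow> (complex \<Rightarrow> complex ^ 'n) set" where
  "mult_z_dom M = {f \<in> hcarrier M. mult_z f \<in> hcarrier M}"

text \<open>Multiplication by \<open>z\<close> on \<open>mult_z_dom M\<close> and \<open>0\<close> on its orthogonal complement.\<close>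

definition model_op ::
  "(complex \<Rightarrow> complex ^ 'n) hspace \<Rightarrow> (complex \<Rightarrow> complex ^ 'n) \<Rightarrow> complex \<Rightarrow> complex ^ 'n" where
  "model_op M f = mult_z (orth_proj M (mult_z_dom M) f)"

definition isometric_multiplier ::
  "(complex \<Rightarrow> complex ^ 'n) hspace \<Rightarrow> (complex \<Rightarrow> complex ^ 'n) hspace \<Rightarrow>
   (complex \<Rightarrow> complex ^ 'n ^ 'n) \<Rightarrow> bool" where
  "isometric_multiplier M N R \<longleftrightarrow>
     (\<forall>i j. (\<lambda>z. R z $ i $ j) holomorphic_on off_circle) \<and>
     (\<forall>f\<in>hcarrier M. (\<lambda>z. R z *v f z) \<in> hcarrier N \<and>
        hnorm N (\<lambda>z. R z *v f z) = hnorm M f)"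

end

theory Submission
  imports Defs
begin

text \<open>
  Write \<open>T\<close> for the transform \<open>f \<mapsto> \<Gamma>(\<cdot>)\<^sup>* f\<close> and \<open>D\<close> for the initial space of \<open>V\<close>. By the
  definition of a model, \<open>T f\<close> vanishes at \<open>z\<close> exactly when \<open>f\<close> lies in the closed subspace
  \<open>(V - z) D\<close>. The intersection of these subspaces over all \<open>z\<close> off the circle reduces \<open>V\<close> to a
  unitary, hence is \<open>0\<close>, so \<open>T\<close> is injective. If \<open>z T f = T g\<close>, then \<open>g - z f \<in> (V - z) D\<close> for all
  \<open>z\<close>, and letting \<open>z \<rightarrow> \<infinity>\<close> shows \<open>f \<in> D\<close>; so \<open>T\<close> carries \<open>V\<close> to the multiplication operator of
  the model space, which makes (1) and (2) equivalent. A multiplier commutes with multiplication by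
  \<open>z\<close>, so (3) implies (2). Finally an isometry \<open>U\<close> as in (1) maps \<open>(A - z) D\<^sub>A\<close> into
  \<open>(B - z) D\<^sub>B\<close>, so the value of the transform of \<open>U f\<close> at \<open>z\<close> depends only, and linearly, on that
  of the transform of \<open>f\<close>; this gives \<open>R(z)\<close>, and Cramer's rule shows that it is analytic.
\<close>

section \<open>Hilbert space geometry\<close>

context complex_inner_product_space
begin

section \<open>Elementary identities for the inner product and the norm\<close>

lemma hcarrier_zero [simp]: "0 \<in> hcarrier H"
  using subspace_0[OF subspace_hcarrier] .

lemma hcarrier_add [simp]: "x \<in> hcarrier H \<Longrightarrow> y \<in> hcarrier H \<Longrightarrow> x + y \<in> hcarrier H"
  using subspace_add[OF subspace_hcarrier] .

lemma hcarrier_diff [simp]: "x \<in> hcarrier H \<Longrightarrow> y \<in> hcarrier H \<Longrightarrow> x - y \<in> hcarrier H"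
  using subspace_diff[OF subspace_hcarrier] .

lemma hcarrier_scale [simp]: "x \<in> hcarrier H \<Longrightarrow> hscale H c x \<in> hcarrier H"
  using subspace_scale[OF subspace_hcarrier] .

lemma hcarrier_sum: "(\<And>i. i \<in> I \<Longrightarrow> f i \<in> hcarrier H) \<Longrightarrow> (\<Sum>i\<in>I. f i) \<in> hcarrier H"
  by (induction I rule: infinite_finite_induct) auto

lemma hinner_diff:
  assumes "x \<in> hcarrier H" "y \<in> hcarrier H" "z \<in> hcarrier H"
  shows "hinner H (x - y) z = hinner H x z - hinner H y z"
  using hinner_add[of "x - y" y z] assms by simp

lemma hinner_diff_right:
  assumes "x \<in> hcarrier H" "y \<in> hcarrier H" "z \<in> hcarrier H"
  shows "hinner H z (x - y) = hinner H z x - hinner H z y"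
  using hinner_add_right[of "x - y" y z] assms by simp

lemma hinner_zero_left [simp]: "x \<in> hcarrier H \<Longrightarrow> hinner H 0 x = 0"
  using hinner_diff[of 0 0 x] by simp

lemma hinner_zero_right [simp]: "x \<in> hcarrier H \<Longrightarrow> hinner H x 0 = 0"
  using hinner_diff_right[of 0 0 x] by simp

lemma hinner_sum_right:
  assumes "\<And>i. i \<in> I \<Longrightarrow> f i \<in> hcarrier H" "x \<in> hcarrier H"
  shows "hinner H x (\<Sum>i\<in>I. f i) = (\<Sum>i\<in>I. hinner H x (f i))"
  using assms(1)
  by (induction I rule: infinite_finite_induct) (auto simp: hinner_add_right hcarrier_sum assms(2))

lemma hnorm_nonneg [simp]: "x \<in> hcarrier H \<Longrightarrow> 0 \<le> hnorm H x"
  by (simp add: hnorm_def hinner_nonneg)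

lemma hnorm_zero [simp]: "hnorm H 0 = 0"
  by (simp add: hnorm_def)

lemma hnorm_eq_zero: "x \<in> hcarrier H \<Longrightarrow> hnorm H x = 0 \<longleftrightarrow> x = 0"
  using hinner_self[of x] hinner_definite[of x] by auto

lemma hnorm_scale: "x \<in> hcarrier H \<Longrightarrow> hnorm H (hscale H c x) = cmod c * hnorm H x"
  using hnorm_add_scale_square[of 0 x c] by (simp add: power_mult_distrib[symmetric])

lemma hnorm_minus_commute:
  assumes "x \<in> hcarrier H" "y \<in> hcarrier H"
  shows "hnorm H (x - y) = hnorm H (y - x)"
  using hnorm_scale[of "x - y" "-1"] assms by simp

lemma hnorm_triangle_diff:
  assumes "x \<in> hcarrier H" "y \<in> hcarrier H" "z \<in> hcarrier H"
  shows "hnorm H (x - z) \<le> hnorm H (x - y) + hnorm H (y - z)"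
  using hnorm_triangle[of "x - y" "y - z"] assms by simp

lemma hnorm_triangle_ineq4:
  assumes "x \<in> hcarrier H" "y \<in> hcarrier H"
  shows "hnorm H (x - y) \<le> hnorm H x + hnorm H y"
  using hnorm_triangle_diff[of x 0 y] hnorm_minus_commute[of 0 y] assms by simp

lemma parallelogram_law:
  assumes "x \<in> hcarrier H" "y \<in> hcarrier H"
  shows "(hnorm H (x + y))\<^sup>2 + (hnorm H (x - y))\<^sup>2 = 2 * (hnorm H x)\<^sup>2 + 2 * (hnorm H y)\<^sup>2"
  using hnorm_add_scale_square[of x y 1] hnorm_add_scale_square[of x y "-1"] assms by simp

section \<open>Sequential form of the norm topology; closed subspaces\<close>

lemma limitin_htopology_iff:
  assumes "\<And>n. s n \<in> hcarrier H" "x \<in> hcarrier H"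
  shows "limitin (htopology H) s x sequentially \<longleftrightarrow> (\<lambda>n. hnorm H (s n - x)) \<longlonglongrightarrow> 0"
proof -
  interpret Metric_space "hcarrier H" "hdist H"
    by (rule Metric_space_hdist)
  show ?thesis
    unfolding htopology_def limitin_metric tendsto_iff
    using assms by (simp add: hdist_def)
qed

text \<open>The topology comes from a metric, so closed means sequentially closed. Kernels,
  orthogonal complements and \<open>ran_tilde\<close> are shown closed in this form.\<close>

lemma closedin_htopology_iff:
  "closedin (htopology H) S \<longleftrightarrow> S \<subseteq> hcarrier H \<and>
     (\<forall>s x. (\<forall>n. s n \<in> S) \<longrightarrow> x \<in> hcarrier H \<longrightarrow> (\<lambda>n. hnorm H (s n - x)) \<longlonglongrightarrow> 0 \<longrightarrow> x \<in> S)"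
proof -
  interpret Metric_space "hcarrier H" "hdist H"
    by (rule Metric_space_hdist)
  have "limitin (htopology H) s x sequentially \<longleftrightarrow>
      x \<in> hcarrier H \<and> (\<lambda>n. hnorm H (s n - x)) \<longlonglongrightarrow> 0"
    if "S \<subseteq> hcarrier H" "\<forall>n. s n \<in> S" for s x
    using that limitin_htopology_iff[of s x] unfolding htopology_def
    by (metis subsetD limitin_mspace)
  then show ?thesis
    unfolding htopology_def metric_closedin_iff_sequentially_closed image_subset_iff
    by (metis UNIV_I)
qed

lemma closedin_htopologyD:
  assumes "closedin (htopology H) S" "\<And>n. s n \<in> S" "x \<in> hcarrier H"
    "(\<lambda>n. hnorm H (s n - x)) \<longlonglongrightarrow> 0"
  shows "x \<in> S"
  using assms closedin_htopology_iff by blast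

lemma subspace_orth_compl:
  assumes "S \<subseteq> hcarrier H"
  shows "subspace (orth_compl H S)"
  unfolding subspace_def orth_compl_def using assms by (auto simp: hinner_add hinner_scale subset_iff)

text \<open>By Cauchy-Schwarz the inner product with a fixed vector is continuous, so orthogonality
  survives limits.\<close>

lemma closed_subspace_orth_compl:
  assumes S: "S \<subseteq> hcarrier H"
  shows "closed_subspace H (orth_compl H S)"
proof -
  have "hinner H x y = 0"
    if s: "\<And>n. s n \<in> orth_compl H S" and x: "x \<in> hcarrier H"
      and lim: "(\<lambda>n. hnorm H (s n - x)) \<longlonglongrightarrow> 0" and y: "y \<in> S" for s x y
  proof -
    have "cmod (hinner H x y) \<le> hnorm H (s n - x) * hnorm H y" for n
    proof -
      have "s n \<in> hcarrier H" "hinner H (s n) y = 0" "y \<in> hcarrier H"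
        using s[of n] y S by (auto simp: orth_compl_def)
      then show ?thesis
        using Cauchy_Schwarz[of "s n - x" y] x by (simp add: hinner_diff)
    qed
    moreover have "(\<lambda>n. hnorm H (s n - x) * hnorm H y) \<longlonglongrightarrow> 0"
      using tendsto_mult_left_zero[OF lim] .
    ultimately have "cmod (hinner H x y) \<le> 0"
      by (meson LIMSEQ_le_const)
    then show ?thesis by simp
  qed
  then show ?thesis
    unfolding closed_subspace_def closedin_htopology_iff
    using subspace_orth_compl[OF S] by (auto simp: orth_compl_def)
qed

end

section \<open>The projection theorem\<close>

context complex_hilbert_space
begin

lemma Cauchy_convergent:
  assumes s: "\<And>n. s n \<in> hcarrier H"
    and cauchy: "\<And>e. e > 0 \<Longrightarrow> \<exists>N. \<forall>m\<ge>N. \<forall>n\<ge>N. hnorm H (s m - s n) < e"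
  obtains x where "x \<in> hcarrier H" "(\<lambda>n. hnorm H (s n - x)) \<longlonglongrightarrow> 0"
proof -
  interpret Metric_space "hcarrier H" "hdist H"
    by (rule Metric_space_hdist)
  have "MCauchy s"
    unfolding MCauchy_def using s cauchy by (auto simp: hdist_def)
  then obtain x where x: "limitin (htopology H) s x sequentially"
    using complete unfolding mcomplete_def htopology_def by blast
  then have "x \<in> hcarrier H"
    unfolding htopology_def by (rule limitin_mspace)
  then show thesis
    using that x limitin_htopology_iff[of s x] s by blast
qed

text \<open>The parallelogram law makes a minimizing sequence Cauchy; its limit lies in
  \<open>M\<close> by closedness and attains the infimum.\<close>

lemma closed_subspace_nearest_point:
  assumes M: "closed_subspace H M" and x: "x \<in> hcarrier H"
  obtains y where "y \<in> M" "\<And>m. m \<in> M \<Longrightarrow> hnorm H (x - y) \<le> hnorm H (x - m)"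
proof -
  have MH: "M \<subseteq> hcarrier H" and sub: "subspace M" and cl: "closedin (htopology H) M"
    using M unfolding closed_subspace_def by auto
  define d where "d = (INF m\<in>M. (hnorm H (x - m))\<^sup>2)"
  have M0: "M \<noteq> {}"
    using subspace_0[OF sub] by blast
  have bdd: "bdd_below ((\<lambda>m. (hnorm H (x - m))\<^sup>2) ` M)"
    by (rule bdd_belowI[of _ 0]) auto
  have d_le: "d \<le> (hnorm H (x - m))\<^sup>2" if "m \<in> M" for m
    unfolding d_def using that bdd by (rule cINF_lower2[OF _ _ order_refl, rotated])
  have "\<exists>m\<in>M. (hnorm H (x - m))\<^sup>2 < d + 1 / real (Suc n)" for n
    using cINF_less_iff[OF M0 bdd, of "d + 1 / real (Suc n)"] unfolding d_def by simp
  then obtain s where s: "\<And>n. s n \<in> M"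
    and s_d: "\<And>n. (hnorm H (x - s n))\<^sup>2 < d + 1 / real (Suc n)"
    by metis
  have sH: "s n \<in> hcarrier H" for n
    using s MH by blast
  have gap: "(hnorm H (s m - s n))\<^sup>2 \<le> 2 / real (Suc m) + 2 / real (Suc n)" for m n
  proof -
    \<comment> \<open>The midpoint of \<open>s m\<close> and \<open>s n\<close> lies in
      \<open>M\<close>, so its squared distance to \<open>x\<close> is at least \<open>d\<close>.
      The parallelogram law then leaves little room for \<open>s m - s n\<close>.\<close>
    define c where "c = hscale H (1/2) (s m + s n)"
    have "c \<in> M"
      unfolding c_def using s sub by (simp add: subspace_add subspace_scale)
    have "hscale H 2 c = s m + s n"
      unfolding c_def by simp
    then have "(x - s m) + (x - s n) = hscale H 2 (x - c)"
      using scale_left_distrib[of 1 1 x] by (simp add: scale_right_diff_distrib algebra_simps)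
    then have "(hnorm H ((x - s m) + (x - s n)))\<^sup>2 = 4 * (hnorm H (x - c))\<^sup>2"
      using x \<open>c \<in> M\<close> MH by (simp add: hnorm_scale power_mult_distrib subset_iff)
    moreover have "(x - s m) - (x - s n) = s n - s m" by simp
    ultimately have "4 * (hnorm H (x - c))\<^sup>2 + (hnorm H (s n - s m))\<^sup>2
        = 2 * (hnorm H (x - s m))\<^sup>2 + 2 * (hnorm H (x - s n))\<^sup>2"
      using parallelogram_law[of "x - s m" "x - s n"] x sH by simp
    moreover have "hnorm H (s n - s m) = hnorm H (s m - s n)"
      using hnorm_minus_commute sH by blast
    ultimately show ?thesis
      using d_le[OF \<open>c \<in> M\<close>] s_d[of m] s_d[of n] by simp
  qed
  have cauchy: "\<exists>N. \<forall>m\<ge>N. \<forall>n\<ge>N. hnorm H (s m - s n) < e" if "e > 0" for e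
  proof -
    obtain N where N: "1 / real (Suc N) < e\<^sup>2 / 4"
      using \<open>e > 0\<close> reals_Archimedean[of "e\<^sup>2 / 4"] by (auto simp: inverse_eq_divide)
    have "hnorm H (s m - s n) < e" if "m \<ge> N" "n \<ge> N" for m n
    proof (rule power2_less_imp_less)
      have "1 / real (Suc m) \<le> 1 / real (Suc N)" "1 / real (Suc n) \<le> 1 / real (Suc N)"
        using that by (simp_all add: frac_le)
      then show "(hnorm H (s m - s n))\<^sup>2 < e\<^sup>2"
        using gap[of m n] N by simp
    qed (use \<open>e > 0\<close> in simp)
    then show ?thesis by blast
  qed
  obtain y where y: "y \<in> hcarrier H" and lim: "(\<lambda>n. hnorm H (s n - y)) \<longlonglongrightarrow> 0"
    using Cauchy_convergent[OF sH cauchy] by blast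
  have "hnorm H (x - y) \<le> sqrt d"
  proof (rule LIMSEQ_le_const)
    show "(\<lambda>n. sqrt (d + 1 / real (Suc n)) + hnorm H (s n - y)) \<longlonglongrightarrow> sqrt d"
    proof -
      have "(\<lambda>n. sqrt (d + 1 / real (Suc n)) + hnorm H (s n - y)) \<longlonglongrightarrow> sqrt (d + 0) + 0"
        by (intro tendsto_add tendsto_const tendsto_real_sqrt LIMSEQ_Suc[OF lim_1_over_n] lim)
      then show ?thesis by simp
    qed
    have "hnorm H (x - y) \<le> sqrt (d + 1 / real (Suc n)) + hnorm H (s n - y)" for n
      using hnorm_triangle_diff[of x "s n" y] x y sH[of n] s_d[of n]
        real_le_rsqrt[of "hnorm H (x - s n)" "d + 1 / real (Suc n)"] by simp
    then show "\<exists>N. \<forall>n\<ge>N. hnorm H (x - y) \<le> sqrt (d + 1 / real (Suc n)) + hnorm H (s n - y)"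
      by blast
  qed
  moreover have "sqrt d \<le> hnorm H (x - m)" if "m \<in> M" for m
    using d_le[OF that] that x MH by (simp add: real_le_lsqrt subset_iff)
  ultimately show thesis
    using that closedin_htopologyD[OF cl s y lim] order_trans by blast
qed

text \<open>Take the nearest point \<open>y\<close>: if \<open>x - y\<close> were not orthogonal to
  some \<open>s\<close> in \<open>M\<close>, moving \<open>y\<close> along \<open>s\<close> would
  bring it closer to \<open>x\<close>.\<close>

lemma orthogonal_decomposition:
  assumes M: "closed_subspace H M" and x: "x \<in> hcarrier H"
  obtains y where "y \<in> M" "x - y \<in> orth_compl H M"
proof -
  have MH: "M \<subseteq> hcarrier H" and sub: "subspace M"
    using M unfolding closed_subspace_def by auto
  obtain y where y: "y \<in> M" and min: "\<And>m. m \<in> M \<Longrightarrow> hnorm H (x - y) \<le> hnorm H (x - m)"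
    using closed_subspace_nearest_point[OF M x] by blast
  have xy: "x - y \<in> hcarrier H"
    using x y MH by auto
  have "hinner H (x - y) s = 0" if s: "s \<in> M" for s
  proof -
    define p where "p = hinner H (x - y) s"
    define N where "N = (hnorm H s)\<^sup>2"
    \<comment> \<open>The best step would be \<open>1 / N\<close>. The summand 1 covers
      \<open>s = 0\<close> and still keeps \<open>t * N < 2\<close>, which is what makes the change
      of the squared distance negative unless \<open>p = 0\<close>.\<close>
    define t where "t = 1 / (N + 1)"
    define c where "c = - of_real t * p"
    have "N \<ge> 0" unfolding N_def by simp
    have sH: "s \<in> hcarrier H"
      using s MH by blast
    have "y - hscale H c s \<in> M"
      using y s sub by (simp add: subspace_diff subspace_scale)
    then have "hnorm H (x - y) \<le> hnorm H (x - y + hscale H c s)"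
      using min[of "y - hscale H c s"] by (simp add: algebra_simps)
    then have "(hnorm H (x - y))\<^sup>2 \<le> (hnorm H (x - y + hscale H c s))\<^sup>2"
      using xy by (intro power_mono) auto
    then have "0 \<le> 2 * Re (cnj c * p) + (cmod c)\<^sup>2 * N"
      using hnorm_add_scale_square[OF xy sH, of c] unfolding p_def N_def by simp
    moreover have "Re (cnj c * p) = - t * (cmod p)\<^sup>2"
      unfolding c_def cmod_power2 by (simp add: power2_eq_square algebra_simps)
    moreover have "(cmod c)\<^sup>2 = t\<^sup>2 * (cmod p)\<^sup>2"
      unfolding c_def by (simp add: norm_mult power_mult_distrib)
    ultimately have "0 \<le> (cmod p)\<^sup>2 * (t * (t * N - 2))"
      by (simp add: power2_eq_square algebra_simps)
    moreover have "t * N < 2" "t > 0"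
      using \<open>N \<ge> 0\<close> unfolding t_def by (auto simp: field_simps)
    ultimately have "(cmod p)\<^sup>2 \<le> 0"
      by (simp add: zero_le_mult_iff)
    then show ?thesis unfolding p_def by simp
  qed
  then show thesis
    using that[OF y] xy unfolding orth_compl_def by blast
qed

text \<open>For \<open>x\<close> in the double complement with component \<open>y\<close> in
  \<open>M\<close>, the rest \<open>x - y\<close> is orthogonal to both \<open>x\<close> and
  \<open>y\<close>, hence to itself.\<close>

lemma orth_compl_orth_compl:
  assumes M: "closed_subspace H M"
  shows "orth_compl H (orth_compl H M) = M"
proof (intro equalityI subsetI)
  have MH: "M \<subseteq> hcarrier H"
    using M unfolding closed_subspace_def by auto
  fix x
  show "x \<in> orth_compl H (orth_compl H M)" if "x \<in> M"
  proof -
    have "hinner H x s = 0" if "s \<in> orth_compl H M" for s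
      using that \<open>x \<in> M\<close> MH hinner_commute[of x s] by (auto simp: orth_compl_def)
    then show ?thesis
      using that MH by (auto simp: orth_compl_def)
  qed
  assume x: "x \<in> orth_compl H (orth_compl H M)"
  then have xH: "x \<in> hcarrier H"
    by (simp add: orth_compl_def)
  obtain y where y: "y \<in> M" and xy: "x - y \<in> orth_compl H M"
    using orthogonal_decomposition[OF M xH] .
  have yH: "y \<in> hcarrier H"
    using y MH by blast
  have "hinner H x (x - y) = 0"
    using x xy by (simp add: orth_compl_def)
  moreover have "hinner H y (x - y) = 0"
    using xy y yH xH hinner_commute[of y "x - y"] by (simp add: orth_compl_def)
  ultimately have "hinner H (x - y) (x - y) = 0"
    using hinner_diff[of x y "x - y"] xH yH by simp
  then have "x - y = 0"
    using hinner_definite[of "x - y"] xH yH by simp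
  then show "x \<in> M"
    using y by simp
qed

end

section \<open>Limits of sequences and intersections of closed subspaces\<close>

context complex_inner_product_space
begin

lemma limit_unique:
  assumes "\<And>n. s n \<in> hcarrier H" "x \<in> hcarrier H" "y \<in> hcarrier H"
    and "(\<lambda>n. hnorm H (s n - x)) \<longlonglongrightarrow> 0" "(\<lambda>n. hnorm H (s n - y)) \<longlonglongrightarrow> 0"
  shows "x = y"
proof -
  have "hnorm H (x - y) \<le> hnorm H (s n - x) + hnorm H (s n - y)" for n
    using hnorm_triangle_diff[of x "s n" y] hnorm_minus_commute[of x "s n"] assms(1-3) by simp
  moreover have "(\<lambda>n. hnorm H (s n - x) + hnorm H (s n - y)) \<longlonglongrightarrow> 0"
    using tendsto_add[OF assms(4,5)] by simp
  ultimately have "hnorm H (x - y) \<le> 0"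
    by (meson LIMSEQ_le_const)
  then have "hnorm H (x - y) = 0"
    using hnorm_nonneg[of "x - y"] assms(2,3) by (simp add: order_antisym)
  then show ?thesis
    using hnorm_eq_zero[of "x - y"] assms(2,3) by simp
qed

lemma convergent_Cauchy:
  assumes "\<And>n. s n \<in> hcarrier H" "x \<in> hcarrier H"
    and lim: "(\<lambda>n. hnorm H (s n - x)) \<longlonglongrightarrow> 0" and "e > 0"
  shows "\<exists>N. \<forall>m\<ge>N. \<forall>n\<ge>N. hnorm H (s m - s n) < e"
proof -
  obtain N where N: "\<And>n. n \<ge> N \<Longrightarrow> hnorm H (s n - x) < e / 2"
    using LIMSEQ_D[OF lim, of "e / 2"] \<open>e > 0\<close> by fastforce
  have "hnorm H (s m - s n) < e" if "m \<ge> N" "n \<ge> N" for m n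
    using N[OF that(1)] N[OF that(2)] hnorm_triangle_diff[of "s m" x "s n"]
      hnorm_minus_commute[of x "s n"] assms(1,2) by simp
  then show ?thesis by blast
qed

text \<open>The index set must be nonempty because the empty intersection is the whole type, which
  may exceed the carrier.\<close>

lemma closed_subspace_INT:
  assumes "I \<noteq> {}" "\<And>i. i \<in> I \<Longrightarrow> closed_subspace H (S i)"
  shows "closed_subspace H (\<Inter>i\<in>I. S i)"
  using assms unfolding closed_subspace_def
  by (auto intro!: subspace_Inter closedin_Inter)

end

section \<open>Partial isometries\<close>

lemma off_circle_iff: "z \<in> off_circle \<longleftrightarrow> cmod z \<noteq> 1"
  by simp

section \<open>Partial isometries on their initial spaces\<close>

locale hilbert_partial_isometry = complex_hilbert_space H
  for H :: "'a::ab_group_add hspace" +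
  fixes V :: "'a \<Rightarrow> 'a"
  assumes partial_isometry: "partial_isometry H V"
begin

abbreviation "initial \<equiv> hker_perp H V"

lemma bounded: "hbounded H H V"
  using partial_isometry unfolding partial_isometry_def by blast

lemma V_carrier [simp]: "x \<in> hcarrier H \<Longrightarrow> V x \<in> hcarrier H"
  and V_add: "x \<in> hcarrier H \<Longrightarrow> y \<in> hcarrier H \<Longrightarrow> V (x + y) = V x + V y"
  and V_scale: "x \<in> hcarrier H \<Longrightarrow> V (hscale H c x) = hscale H c (V x)"
  using bounded unfolding hbounded_def hlinear_def by auto

lemma V_diff: "x \<in> hcarrier H \<Longrightarrow> y \<in> hcarrier H \<Longrightarrow> V (x - y) = V x - V y"
  using V_add[of "x - y" y] by simp

lemma V_zero [simp]: "V 0 = 0"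
  using V_diff[of 0 0] by simp

lemma V_limit:
  assumes "\<And>n. s n \<in> hcarrier H" "x \<in> hcarrier H" "(\<lambda>n. hnorm H (s n - x)) \<longlonglongrightarrow> 0"
  shows "(\<lambda>n. hnorm H (V (s n) - V x)) \<longlonglongrightarrow> 0"
proof -
  obtain C where C: "\<And>x. x \<in> hcarrier H \<Longrightarrow> hnorm H (V x) \<le> C * hnorm H x"
    using bounded unfolding hbounded_def by blast
  have "(\<lambda>n. C * hnorm H (s n - x)) \<longlonglongrightarrow> 0"
    using tendsto_mult_right_zero[OF assms(3)] .
  then show ?thesis
  proof (rule Lim_null_comparison[rotated])
    show "\<forall>\<^sub>F n in sequentially. norm (hnorm H (V (s n) - V x)) \<le> C * hnorm H (s n - x)"
      using C[of "s n - x" for n] assms(1,2) by (simp add: V_diff)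
  qed
qed

lemma hker_subset: "hker H V \<subseteq> hcarrier H"
  unfolding hker_def by blast

lemma closed_subspace_hker: "closed_subspace H (hker H V)"
proof -
  have "subspace (hker H V)"
    unfolding subspace_def hker_def by (auto simp: V_add V_scale)
  moreover have "x \<in> hker H V"
    if s: "\<And>n. s n \<in> hker H V" and x: "x \<in> hcarrier H"
      and lim: "(\<lambda>n. hnorm H (s n - x)) \<longlonglongrightarrow> 0" for s x
  proof -
    have sH: "s n \<in> hcarrier H" and V0: "V (s n) = 0" for n
      using s[of n] unfolding hker_def by auto
    have "(\<lambda>n. hnorm H (0 - V x)) \<longlonglongrightarrow> 0"
      using V_limit[OF sH x lim] V0 by simp
    then have "V x = 0"
      using limit_unique[of "\<lambda>n. 0" "V x" 0] x by simp
    then show ?thesis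
      using x unfolding hker_def by blast
  qed
  ultimately show ?thesis
    unfolding closed_subspace_def closedin_htopology_iff
    using hker_subset by blast
qed

lemma closed_subspace_initial: "closed_subspace H initial"
  using closed_subspace_orth_compl[OF hker_subset] .

lemma subspace_initial: "subspace initial"
  and initial_carrier: "x \<in> initial \<Longrightarrow> x \<in> hcarrier H"
  using closed_subspace_initial unfolding closed_subspace_def by auto

lemma hnorm_V: "x \<in> initial \<Longrightarrow> hnorm H (V x) = hnorm H x"
  using partial_isometry unfolding partial_isometry_def by blast

text \<open>Polarization: \<open>V\<close> preserves the norm of \<open>x + hscale H c y\<close>,
  and \<open>c = 1\<close> and \<open>c = \<i>\<close> yield the real and the imaginary
  part.\<close>

lemma hinner_V_V_initial:
  assumes x: "x \<in> initial" and y: "y \<in> initial"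
  shows "hinner H (V x) (V y) = hinner H x y"
proof -
  note xy = initial_carrier[OF x] initial_carrier[OF y]
  have "Re (cnj c * hinner H (V x) (V y)) = Re (cnj c * hinner H x y)" for c
  proof -
    have "x + hscale H c y \<in> initial"
      using x y subspace_initial by (simp add: subspace_add subspace_scale)
    then have "hnorm H (V x + hscale H c (V y)) = hnorm H (x + hscale H c y)"
      using hnorm_V xy by (metis V_add V_scale hcarrier_scale)
    then show ?thesis
      using hnorm_add_scale_square[of x y c] hnorm_add_scale_square[of "V x" "V y" c] xy
        hnorm_V[OF x] hnorm_V[OF y] by simp
  qed
  from this[of 1] this[of \<i>] show ?thesis
    by (simp add: complex_eq_iff)
qed

text \<open>The kernel component of \<open>x\<close> is killed by \<open>V\<close> and orthogonal to
  \<open>y\<close>, so only \<open>y\<close> has to be initial. This makes the complement of the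
  unitary part invariant in \<open>INT_ran_tilde\<close>.\<close>

lemma hinner_V_V:
  assumes x: "x \<in> hcarrier H" and y: "y \<in> initial"
  shows "hinner H (V x) (V y) = hinner H x y"
proof -
  obtain k where k: "k \<in> hker H V" and d: "x - k \<in> initial"
    using orthogonal_decomposition[OF closed_subspace_hker x] .
  have kH: "k \<in> hcarrier H" and V0: "V k = 0"
    using k unfolding hker_def by auto
  have yH: "y \<in> hcarrier H"
    using initial_carrier[OF y] .
  have "hinner H k y = 0"
    using y k yH kH hinner_commute[of k y] unfolding orth_compl_def by simp
  then show ?thesis
    using hinner_V_V_initial[OF d y] x kH yH V0 by (simp add: V_diff hinner_diff)
qed

text \<open>Triangle inequality with \<open>hnorm H (V x) = hnorm H x\<close>. Together the two
  bounds say that \<open>V - z\<close> is bounded below on \<open>initial\<close> for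
  \<open>z\<close> off the circle.\<close>

lemma hnorm_le_hnorm_shift:
  assumes "x \<in> initial"
  shows "(1 - cmod z) * hnorm H x \<le> hnorm H (V x - hscale H z x)"
    and "(cmod z - 1) * hnorm H x \<le> hnorm H (V x - hscale H z x)"
proof -
  have x: "x \<in> hcarrier H"
    using initial_carrier[OF assms] .
  show "(1 - cmod z) * hnorm H x \<le> hnorm H (V x - hscale H z x)"
    using hnorm_triangle[of "V x - hscale H z x" "hscale H z x"] x hnorm_V[OF assms]
    by (simp add: hnorm_scale algebra_simps)
  show "(cmod z - 1) * hnorm H x \<le> hnorm H (V x - hscale H z x)"
    using hnorm_triangle_ineq4[of "V x" "V x - hscale H z x"] x hnorm_V[OF assms]
    by (simp add: hnorm_scale algebra_simps)
qed

section \<open>The subspaces \<open>ran_tilde H V z\<close> and their intersection\<close>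

lemma ran_tilde_subset: "ran_tilde H V z \<subseteq> hcarrier H"
  unfolding ran_tilde_def using initial_carrier by auto

lemma subspace_ran_tilde: "subspace (ran_tilde H V z)"
  unfolding subspace_def ran_tilde_def
proof (intro conjI ballI allI)
  show "0 \<in> (\<lambda>x. V x - hscale H z x) ` initial"
    using subspace_0[OF subspace_initial] by (intro image_eqI[of _ _ 0]) auto
next
  fix a b assume "a \<in> (\<lambda>x. V x - hscale H z x) ` initial" "b \<in> (\<lambda>x. V x - hscale H z x) ` initial"
  then obtain x y where "x \<in> initial" "a = V x - hscale H z x" "y \<in> initial" "b = V y - hscale H z y"
    by blast
  then show "a + b \<in> (\<lambda>x. V x - hscale H z x) ` initial"
    using subspace_add[OF subspace_initial] initial_carrier
    by (intro image_eqI[of _ _ "x + y"]) (auto simp: V_add scale_right_distrib)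
next
  fix c a assume "a \<in> (\<lambda>x. V x - hscale H z x) ` initial"
  then obtain x where "x \<in> initial" "a = V x - hscale H z x"
    by blast
  then show "hscale H c a \<in> (\<lambda>x. V x - hscale H z x) ` initial"
    using subspace_scale[OF subspace_initial] initial_carrier
    by (intro image_eqI[of _ _ "hscale H c x"]) (auto simp: V_scale scale_right_diff_distrib mult.commute)
qed

text \<open>Since \<open>V - z\<close> is bounded below on \<open>initial\<close>, the preimages of
  a convergent sequence are Cauchy; their limit stays in the closed subspace
  \<open>initial\<close>.\<close>

lemma closed_subspace_ran_tilde:
  assumes z: "z \<in> off_circle"
  shows "closed_subspace H (ran_tilde H V z)"
proof -
  define q where "q = \<bar>1 - cmod z\<bar>"
  have q: "q > 0"
    using z unfolding q_def off_circle_iff by simp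
  have lower: "q * hnorm H x \<le> hnorm H (V x - hscale H z x)" if "x \<in> initial" for x
    using hnorm_le_hnorm_shift[OF that, of z] unfolding q_def abs_if by (simp add: algebra_simps)
  have "y \<in> ran_tilde H V z"
    if s: "\<And>n. s n \<in> ran_tilde H V z" and y: "y \<in> hcarrier H"
      and lim: "(\<lambda>n. hnorm H (s n - y)) \<longlonglongrightarrow> 0" for s y
  proof -
    have sH: "s n \<in> hcarrier H" for n
      using s ran_tilde_subset by blast
    have "\<exists>x\<in>initial. s n = V x - hscale H z x" for n
      using s[of n] unfolding ran_tilde_def by blast
    then obtain x where x: "\<And>n. x n \<in> initial" and sx: "\<And>n. s n = V (x n) - hscale H z (x n)"
      by metis
    have xH: "x n \<in> hcarrier H" for n
      using initial_carrier[OF x] .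
    have dist: "q * hnorm H (x m - x n) \<le> hnorm H (s m - s n)" for m n
      using lower[OF subspace_diff[OF subspace_initial x x], of m n] xH
      by (simp add: sx V_diff scale_right_diff_distrib algebra_simps)
    have "\<exists>N. \<forall>m\<ge>N. \<forall>n\<ge>N. hnorm H (x m - x n) < e" if "e > 0" for e
    proof -
      have "e * q > 0"
        using that q by simp
      then obtain N where N: "\<forall>m\<ge>N. \<forall>n\<ge>N. hnorm H (s m - s n) < e * q"
        using convergent_Cauchy[OF sH y lim] by blast
      have "hnorm H (x m - x n) < e" if "m \<ge> N" "n \<ge> N" for m n
      proof -
        have "q * hnorm H (x m - x n) < q * e"
          using dist[of m n] N that by (smt (verit) mult.commute)
        then show ?thesis
          using q by simp
      qed
      then show ?thesis by blast
    qed
    then obtain w where w: "w \<in> hcarrier H" and xw: "(\<lambda>n. hnorm H (x n - w)) \<longlonglongrightarrow> 0"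
      using Cauchy_convergent[of x] xH by blast
    have wD: "w \<in> initial"
      using closedin_htopologyD[of initial x w] closed_subspace_initial x w xw
      unfolding closed_subspace_def by blast
    have le: "hnorm H (s n - (V w - hscale H z w)) \<le> hnorm H (V (x n) - V w) + cmod z * hnorm H (x n - w)" for n
    proof -
      have "s n - (V w - hscale H z w) = (V (x n) - V w) - hscale H z (x n - w)"
        using sx by (simp add: scale_right_diff_distrib)
      then show ?thesis
        using hnorm_triangle_ineq4[of "V (x n) - V w" "hscale H z (x n - w)"] xH[of n] w
        by (simp only: hnorm_scale V_carrier hcarrier_diff hcarrier_scale)
    qed
    have "(\<lambda>n. hnorm H (V (x n) - V w) + cmod z * hnorm H (x n - w)) \<longlonglongrightarrow> 0"
      using tendsto_add[OF V_limit[OF xH w xw] tendsto_mult_right_zero[OF xw]] by simp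
    then have "(\<lambda>n. hnorm H (s n - (V w - hscale H z w))) \<longlonglongrightarrow> 0"
      by (rule Lim_null_comparison[rotated]) (use le sH w in auto)
    then have "y = V w - hscale H z w"
      using limit_unique[of s y "V w - hscale H z w"] lim y w sH by simp
    then show ?thesis
      using wD unfolding ran_tilde_def by blast
  qed
  then show ?thesis
    unfolding closed_subspace_def closedin_htopology_iff
    using subspace_ran_tilde ran_tilde_subset by blast
qed

text \<open>Solving \<open>g - z f = (V - z) y\<close> with \<open>y \<in> initial\<close>, one has \<open>y \<rightarrow> f\<close> as \<open>z \<rightarrow> \<infinity>\<close>.\<close>

lemma initial_if_ran_tilde:
  assumes f: "f \<in> hcarrier H" and g: "g \<in> hcarrier H"
    and ran: "\<And>z. z \<in> off_circle \<Longrightarrow> g - hscale H z f \<in> ran_tilde H V z"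
  shows "f \<in> initial"
proof -
  \<comment> \<open>Points tending to infinity; the offset 2 makes \<open>cmod (c n) - 1\<close> at
    least 1, so the lower bound for \<open>V - c n\<close> never degenerates.\<close>
  define c where "c n = complex_of_real (real n + 2)" for n
  have c: "cmod (c n) = real n + 2" "c n \<in> off_circle" for n
  proof -
    show n: "cmod (c n) = real n + 2"
      unfolding c_def norm_of_real by simp
    show "c n \<in> off_circle"
      unfolding off_circle_iff n by simp
  qed
  have "\<exists>y\<in>initial. g - hscale H (c n) f = V y - hscale H (c n) y" for n
    using ran[OF c(2)[of n]] unfolding ran_tilde_def by blast
  then obtain y where y: "\<And>n. y n \<in> initial"
    and eq: "\<And>n. g - hscale H (c n) f = V (y n) - hscale H (c n) (y n)"
    by metis
  have yH: "y n \<in> hcarrier H" for n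
    using initial_carrier[OF y] .
  define K where "K = 2 * hnorm H g + 2 * hnorm H f"
  have le: "hnorm H (y n - f) \<le> K / real (Suc n)" for n
  proof -
    have pos: "hnorm H g \<ge> 0" "hnorm H f \<ge> 0" "hnorm H (y n - f) \<ge> 0"
      using f g yH by auto
    have "(real n + 1) * hnorm H (y n) \<le> hnorm H (g - hscale H (c n) f)"
      using hnorm_le_hnorm_shift(2)[OF y, of "c n" n] c(1)[of n] by (simp add: eq add.commute)
    also have "\<dots> \<le> hnorm H g + (real n + 2) * hnorm H f"
      using hnorm_triangle_ineq4[of g "hscale H (c n) f"] f g c(1)[of n] by (simp add: hnorm_scale)
    also have "\<dots> \<le> (real n + 1) * (hnorm H g + 2 * hnorm H f)"
      using pos by (simp add: algebra_simps)
    finally have yn: "hnorm H (y n) \<le> hnorm H g + 2 * hnorm H f"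
      by simp
    \<comment> \<open>The right-hand side stays bounded by \<open>K\<close> while the factor
      \<open>c n\<close> grows, which forces \<open>y n\<close> towards \<open>f\<close>.\<close>
    have "hscale H (c n) (y n - f) = V (y n) - g"
      using eq[of n] by (simp add: scale_right_diff_distrib algebra_simps)
    then have "(real n + 2) * hnorm H (y n - f) = hnorm H (V (y n) - g)"
      using hnorm_scale[of "y n - f" "c n"] yH f c(1)[of n] by simp
    also have "\<dots> \<le> hnorm H (y n) + hnorm H g"
      using hnorm_triangle_ineq4[of "V (y n)" g] yH g hnorm_V[OF y] by simp
    also have "\<dots> \<le> K"
      using yn unfolding K_def by simp
    finally have "real (Suc n) * hnorm H (y n - f) \<le> K"
      using pos(3) by (simp add: algebra_simps)
    then show ?thesis
      by (simp add: field_simps)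
  qed
  have "(\<lambda>n. K / real (Suc n)) \<longlonglongrightarrow> 0"
    using tendsto_mult_right_zero[OF LIMSEQ_Suc[OF lim_1_over_n], of K] by simp
  then have "(\<lambda>n. hnorm H (y n - f)) \<longlonglongrightarrow> 0"
    by (rule Lim_null_comparison[rotated]) (use le yH f in auto)
  then show ?thesis
    using closedin_htopologyD[of initial y f] closed_subspace_initial y f
    unfolding closed_subspace_def by blast
qed

text \<open>Multiples of \<open>f\<close> lie in every \<open>ran_tilde H V z\<close>, so
  \<open>initial_if_ran_tilde\<close> applies with \<open>g = 0\<close>. Then \<open>V f\<close> is
  the sum of \<open>V f - z f\<close> and \<open>z f\<close>, both in
  \<open>ran_tilde H V z\<close>.\<close>

lemma V_mem_INT_ran_tilde:
  assumes f: "f \<in> (\<Inter>z\<in>off_circle. ran_tilde H V z)"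
  shows "f \<in> initial" "V f \<in> (\<Inter>z\<in>off_circle. ran_tilde H V z)"
proof -
  have fH: "f \<in> hcarrier H"
    using f ran_tilde_subset[of 0] by auto
  show fD: "f \<in> initial"
  proof (rule initial_if_ran_tilde[OF fH hcarrier_zero])
    fix z assume "z \<in> off_circle"
    then have "hscale H (- z) f \<in> ran_tilde H V z"
      using f subspace_scale[OF subspace_ran_tilde] by blast
    then show "0 - hscale H z f \<in> ran_tilde H V z"
      by simp
  qed
  show "V f \<in> (\<Inter>z\<in>off_circle. ran_tilde H V z)"
  proof
    fix z assume z: "z \<in> off_circle"
    then have "hscale H z f \<in> ran_tilde H V z"
      using f subspace_scale[OF subspace_ran_tilde] by blast
    moreover have "V f - hscale H z f \<in> ran_tilde H V z"
      using fD unfolding ran_tilde_def by blast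
    ultimately show "V f \<in> ran_tilde H V z"
      using subspace_add[OF subspace_ran_tilde] by fastforce
  qed
qed

text \<open>For \<open>z \<noteq> 0\<close> and \<open>V x\<^sub>0 = (V - z) x\<close> one has \<open>x\<^sub>0 = (V - z) ((x - x\<^sub>0) / z)\<close>
  and \<open>x = V ((x - x\<^sub>0) / z)\<close>; the case \<open>z = 0\<close> follows from \<open>x \<rightarrow> x\<^sub>0\<close> as \<open>z \<rightarrow> 0\<close>.\<close>

lemma INT_ran_tilde_preimage:
  assumes x0: "x0 \<in> initial" and Vx0: "V x0 \<in> (\<Inter>z\<in>off_circle. ran_tilde H V z)"
  shows "x0 \<in> (\<Inter>z\<in>off_circle. ran_tilde H V z)"
proof
  note x0H = initial_carrier[OF x0]
  have key: "V (hscale H (1 / z) (x - x0)) = x" "hscale H (1 / z) (x - x0) \<in> initial"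
    if x: "x \<in> initial" and eq: "V x0 = V x - hscale H z x" and "z \<noteq> 0" for x z
  proof -
    have "V x - V x0 = hscale H z x"
      using eq by simp
    then show "V (hscale H (1 / z) (x - x0)) = x"
      using \<open>z \<noteq> 0\<close> initial_carrier[OF x] x0H by (simp add: V_scale V_diff)
    show "hscale H (1 / z) (x - x0) \<in> initial"
      using x x0 subspace_initial by (simp add: subspace_scale subspace_diff)
  qed
  fix z assume z: "z \<in> off_circle"
  show "x0 \<in> ran_tilde H V z"
  proof (cases "z = 0")
    case False
    obtain x where x: "x \<in> initial" and eq: "V x0 = V x - hscale H z x"
      using Vx0 z unfolding ran_tilde_def by blast
    define y where "y = hscale H (1 / z) (x - x0)"
    have "hscale H z y = x - x0"
      using False unfolding y_def by simp
    then have "x0 = V y - hscale H z y"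
      using key(1)[OF x eq False] unfolding y_def[symmetric] by simp
    then show ?thesis
      using key(2)[OF x eq False] unfolding ran_tilde_def y_def[symmetric] by (rule image_eqI)
  next
    case True
    define c where "c n = complex_of_real (1 / (real n + 2))" for n
    have c: "cmod (c n) = 1 / (real n + 2)" "c n \<in> off_circle" "c n \<noteq> 0" for n
    proof -
      show n: "cmod (c n) = 1 / (real n + 2)"
        unfolding c_def norm_of_real by simp
      show "c n \<in> off_circle"
        unfolding off_circle_iff n by simp
      show "c n \<noteq> 0"
        using n by auto
    qed
    have "\<exists>x\<in>initial. V x0 = V x - hscale H (c n) x" for n
      using Vx0 c(2)[of n] unfolding ran_tilde_def by blast
    then obtain x where x: "\<And>n. x n \<in> initial" and eq: "\<And>n. V x0 = V (x n) - hscale H (c n) (x n)"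
      by metis
    have xH: "x n \<in> hcarrier H" for n
      using initial_carrier[OF x] .
    \<comment> \<open>By \<open>key\<close> each \<open>x n\<close> is the image under
      \<open>V\<close> of an initial vector; closedness of \<open>ran_tilde H V 0\<close> will pass
      this on to the limit \<open>x0\<close>.\<close>
    have ran: "x n \<in> ran_tilde H V 0" for n
      using key(2)[OF x eq c(3)] key(1)[OF x eq c(3), symmetric] unfolding ran_tilde_def
      by (intro image_eqI) auto
    \<comment> \<open>As \<open>x n - x0\<close> is initial, its norm is that of
      \<open>V (x n - x0)\<close>, which is \<open>c n\<close> times \<open>x n\<close>; the norms
      of the \<open>x n\<close> are bounded because \<open>c n\<close> stays away from the
      circle.\<close>
    have le: "hnorm H (x n - x0) \<le> hnorm H x0 / real (Suc n)" for n
    proof -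
      have "(1 - 1 / (real n + 2)) * hnorm H (x n) \<le> hnorm H x0"
        using hnorm_le_hnorm_shift(1)[OF x, of "c n" n] c(1)[of n] hnorm_V[OF x0] by (simp add: eq[symmetric])
      then have "(real n + 1) * hnorm H (x n) \<le> (real n + 2) * hnorm H x0"
        by (simp add: field_simps)
      then have "hnorm H (x n) / (real n + 2) \<le> hnorm H x0 / (real n + 1)"
        by (simp add: field_simps)
      moreover have "V (x n - x0) = hscale H (c n) (x n)"
        using eq[of n] xH x0H by (simp add: V_diff)
      then have "hnorm H (x n - x0) = hnorm H (x n) / (real n + 2)"
        using hnorm_V[OF subspace_diff[OF subspace_initial x x0], of n] hnorm_scale[OF xH, of "c n" n] c(1)[of n]
        by simp
      ultimately show ?thesis
        by (simp add: add.commute)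
    qed
    have "(\<lambda>n. hnorm H x0 / real (Suc n)) \<longlonglongrightarrow> 0"
      using tendsto_mult_right_zero[OF LIMSEQ_Suc[OF lim_1_over_n], of "hnorm H x0"] by simp
    then have "(\<lambda>n. hnorm H (x n - x0)) \<longlonglongrightarrow> 0"
      by (rule Lim_null_comparison[rotated]) (use le xH x0H in auto)
    then have "x0 \<in> ran_tilde H V 0"
      using closedin_htopologyD[of _ x x0] closed_subspace_ran_tilde[of 0] ran x0H
      unfolding closed_subspace_def by auto
    then show ?thesis
      using True by simp
  qed
qed

text \<open>Taking \<open>z = 0\<close> writes each vector of the intersection \<open>M\<close> as
  \<open>V g\<close>, and \<open>INT_ran_tilde_preimage\<close> puts \<open>g\<close> in
  \<open>M\<close>, so \<open>V\<close> maps \<open>M\<close> isometrically onto \<open>M\<close>.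
  By \<open>hinner_V_V\<close> the complement of \<open>M\<close> is invariant too, so
  \<open>M\<close> reduces \<open>V\<close> to a unitary.\<close>

lemma INT_ran_tilde:
  assumes cnu: "completely_non_unitary H V"
  shows "(\<Inter>z\<in>off_circle. ran_tilde H V z) = {0}"
proof -
  define M where "M = (\<Inter>z\<in>off_circle. ran_tilde H V z)"
  have clM: "closed_subspace H M"
    unfolding M_def
  proof (rule closed_subspace_INT)
    show "off_circle \<noteq> {}"
      using off_circle_iff[of 0] by force
  qed (rule closed_subspace_ran_tilde)
  have MD: "f \<in> initial" and VM: "V f \<in> M" if "f \<in> M" for f
    using V_mem_INT_ran_tilde that unfolding M_def by auto
  have pre: "\<exists>g\<in>M. f = V g" if f: "f \<in> M" for f
  proof -
    have "(0::complex) \<in> off_circle"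
      unfolding off_circle_iff by simp
    then have "f \<in> ran_tilde H V 0"
      using f unfolding M_def by blast
    then obtain g where "g \<in> initial" "f = V g"
      unfolding ran_tilde_def by auto
    then show ?thesis
      using INT_ran_tilde_preimage f unfolding M_def by blast
  qed
  have "V g \<in> orth_compl H M" if g: "g \<in> orth_compl H M" for g
  proof -
    have gH: "g \<in> hcarrier H"
      using g by (simp add: orth_compl_def)
    have "hinner H (V g) f = 0" if "f \<in> M" for f
      using pre[OF that] hinner_V_V[OF gH] MD g by (auto simp: orth_compl_def)
    then show ?thesis
      using gH by (simp add: orth_compl_def)
  qed
  then have "reduces H M V"
    unfolding reduces_def using clM VM by blast
  moreover have "unitary_on H M V"
    unfolding unitary_on_def using VM pre hinner_V_V_initial[OF MD MD] by blast
  ultimately have "M = {0}"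
    using cnu unfolding completely_non_unitary_def by metis
  then show ?thesis
    unfolding M_def .
qed

end

section \<open>Models\<close>

lemma cvec_space_simps [simp]:
  "hcarrier cvec_space = UNIV" "hscale cvec_space = (*s)"
  "hinner cvec_space x y = (\<Sum>i\<in>UNIV. x $ i * cnj (y $ i))"
  by (simp_all add: cvec_space_def)

lemma hnorm_cvec_space_axis: "hnorm cvec_space (axis i 1) = 1"
proof -
  have "(\<Sum>j\<in>UNIV. axis i 1 $ j * cnj (axis i 1 $ j)) = (\<Sum>j\<in>UNIV. if j = i then 1 else 0 :: complex)"
    by (rule sum.cong) (auto simp: axis_def)
  then show ?thesis
    by (simp add: hnorm_def)
qed

text \<open>A real supremum is an upper bound only for a set bounded above, which \<open>C\<close>
  guarantees. The sign of \<open>C\<close> is unknown, hence the absolute value.\<close>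

lemma hnorm_le_hopnorm:
  assumes "\<And>x. x \<in> hcarrier H \<Longrightarrow> hnorm H x \<ge> 0"
    and bdd: "\<And>x. x \<in> hcarrier H \<Longrightarrow> hnorm K (T x) \<le> C * hnorm H x"
    and x: "x \<in> hcarrier H" "hnorm H x \<le> 1"
  shows "hnorm K (T x) \<le> hopnorm H K T"
  unfolding hopnorm_def
proof (rule cSUP_upper)
  have "hnorm K (T y) \<le> \<bar>C\<bar>" if "y \<in> hcarrier H" "hnorm H y \<le> 1" for y
  proof -
    have "C * hnorm H y \<le> \<bar>C\<bar> * 1"
      using that assms(1)[of y] by (intro mult_mono) auto
    then show ?thesis
      using bdd[OF that(1)] by simp
  qed
  then show "bdd_above ((\<lambda>x. hnorm K (T x)) ` {x \<in> hcarrier H. hnorm H x \<le> 1})"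
    by (auto intro!: bdd_aboveI[of _ "\<bar>C\<bar>"])
qed (use x in simp)

lemma hisometry_compose:
  assumes "hisometry H K U" "hisometry K L W"
  shows "hisometry H L (W \<circ> U)"
  using assms unfolding hisometry_def hlinear_def by (auto simp: image_subset_iff)

text \<open>Intertwining isometries compose. This transfers the relation between operators and their
  models.\<close>

lemma preceq_trans:
  assumes "preceq H A K B" "preceq K B L C"
  shows "preceq H A L C"
proof -
  obtain U where U: "hisometry H K U" "U ` hker_perp H A \<subseteq> hker_perp K B"
    "\<forall>x\<in>hker_perp H A. U (A x) = B (U x)"
    using assms(1) unfolding preceq_def by blast
  obtain W where W: "hisometry K L W" "W ` hker_perp K B \<subseteq> hker_perp L C"
    "\<forall>x\<in>hker_perp K B. W (B x) = C (W x)"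
    using assms(2) unfolding preceq_def by blast
  have "(W \<circ> U) ` hker_perp H A \<subseteq> hker_perp L C"
    "\<forall>x\<in>hker_perp H A. (W \<circ> U) (A x) = C ((W \<circ> U) x)"
    using U(2,3) W(2,3) by auto
  then show ?thesis
    unfolding preceq_def using hisometry_compose[OF U(1) W(1)] by blast
qed

section \<open>The transform of a model and its zeros\<close>

locale cnu_model = hilbert_partial_isometry H V
  for H :: "'a::ab_group_add hspace" and V :: "'a \<Rightarrow> 'a" +
  fixes \<Gamma> :: "complex \<Rightarrow> complex ^ 'n \<Rightarrow> 'a"
  assumes cnu: "completely_non_unitary H V"
    and model: "is_model H V \<Gamma>"
begin

abbreviation "M \<equiv> model_space H \<Gamma>"
abbreviation "T \<equiv> model_transform H \<Gamma>"

lemma \<Gamma>_bounded: "z \<in> off_circle \<Longrightarrow> hbounded cvec_space H (\<Gamma> z)"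
  and \<Gamma>_bij: "z \<in> off_circle \<Longrightarrow> bij_betw (\<Gamma> z) UNIV (orth_compl H (ran_tilde H V z))"
  and \<Gamma>_anti_analytic: "anti_analytic_on cvec_space H \<Gamma> off_circle"
  using model unfolding is_model_def by blast+

lemma \<Gamma>_carrier: "z \<in> off_circle \<Longrightarrow> \<Gamma> z u \<in> hcarrier H"
  and \<Gamma>_add: "z \<in> off_circle \<Longrightarrow> \<Gamma> z (u + v) = \<Gamma> z u + \<Gamma> z v"
  and \<Gamma>_scale: "z \<in> off_circle \<Longrightarrow> \<Gamma> z (c *s u) = hscale H c (\<Gamma> z u)"
  using \<Gamma>_bounded[of z] unfolding hbounded_def hlinear_def by auto

lemma \<Gamma>_zero: "z \<in> off_circle \<Longrightarrow> \<Gamma> z 0 = 0"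
  using \<Gamma>_add[of z 0 0] by simp

lemma \<Gamma>_sum: "z \<in> off_circle \<Longrightarrow> \<Gamma> z (\<Sum>i\<in>I. u i) = (\<Sum>i\<in>I. \<Gamma> z (u i))"
  by (induction I rule: infinite_finite_induct) (simp_all add: \<Gamma>_add \<Gamma>_zero)

lemma hinner_\<Gamma>:
  assumes z: "z \<in> off_circle" and f: "f \<in> hcarrier H"
  shows "hinner H f (\<Gamma> z u) = (\<Sum>i\<in>UNIV. hinner H f (\<Gamma> z (axis i 1)) * cnj (u $ i))"
proof -
  have "\<Gamma> z u = (\<Sum>i\<in>UNIV. hscale H (u $ i) (\<Gamma> z (axis i 1)))"
    using \<Gamma>_sum[OF z, of "\<lambda>i. u $ i *s axis i 1" UNIV]
    by (simp add: basis_expansion \<Gamma>_scale[OF z])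
  then show ?thesis
    using f \<Gamma>_carrier[OF z] by (simp add: hinner_sum_right hinner_scale_right mult.commute)
qed

text \<open>\<open>hadjoint\<close> is a definite description: \<open>hinner_\<Gamma>\<close> shows
  that this vector qualifies, and testing against basis vectors shows that no other does.\<close>

lemma T_nth:
  assumes z: "z \<in> off_circle" and f: "f \<in> hcarrier H"
  shows "T f z $ i = hinner H f (\<Gamma> z (axis i 1))"
proof -
  have "hadjoint cvec_space H (\<Gamma> z) f = (\<chi> i. hinner H f (\<Gamma> z (axis i 1)))"
    unfolding hadjoint_def
  proof (rule the_equality, safe)
    fix u
    show "hinner cvec_space (\<chi> i. hinner H f (\<Gamma> z (axis i 1))) u = hinner H f (\<Gamma> z u)"
      using hinner_\<Gamma>[OF z f, of u] by simp
  next
    fix x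
    assume x: "\<forall>u\<in>hcarrier cvec_space. hinner cvec_space x u = hinner H f (\<Gamma> z u)"
    have "x $ i = hinner H f (\<Gamma> z (axis i 1))" for i
    proof -
      have "hinner cvec_space x (axis i 1) = (\<Sum>j\<in>UNIV. if j = i then x $ j else 0)"
        unfolding cvec_space_simps by (rule sum.cong) (auto simp: axis_def)
      then show ?thesis
        using x by simp
    qed
    then show "x = (\<chi> i. hinner H f (\<Gamma> z (axis i 1)))"
      by (simp add: vec_eq_iff)
  qed simp
  then show ?thesis
    using z by (simp add: model_transform_def)
qed

text \<open>The default value 0 lets identities between transforms hold at every point of the plane,
  hence as equalities of functions.\<close>

lemma T_on_circle: "z \<notin> off_circle \<Longrightarrow> T f z = 0"
  by (simp add: model_transform_def)

lemma T_add:
  assumes "f \<in> hcarrier H" "g \<in> hcarrier H"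
  shows "T (f + g) z = T f z + T g z"
proof (cases "z \<in> off_circle")
  case True
  then show ?thesis
    using assms \<Gamma>_carrier by (simp add: vec_eq_iff T_nth hinner_add)
qed (simp add: T_on_circle)

lemma T_scale:
  assumes "f \<in> hcarrier H"
  shows "T (hscale H c f) z = c *s T f z"
proof (cases "z \<in> off_circle")
  case True
  then show ?thesis
    using assms \<Gamma>_carrier by (simp add: vec_eq_iff T_nth hinner_scale)
qed (simp add: T_on_circle)

lemma T_diff: "f \<in> hcarrier H \<Longrightarrow> g \<in> hcarrier H \<Longrightarrow> T (f - g) z = T f z - T g z"
  using T_add[of "f - g" g z] by simp

lemma T_sum:
  assumes "\<And>i. i \<in> I \<Longrightarrow> f i \<in> hcarrier H"
  shows "T (\<Sum>i\<in>I. f i) z = (\<Sum>i\<in>I. T (f i) z)"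
  using assms
proof (induction I rule: infinite_finite_induct)
  case (insert i I)
  then show ?case
    by (simp add: T_add hcarrier_sum)
qed (use T_diff[of 0 0 z] in auto)

text \<open>The zeros are the vectors orthogonal to the range of \<open>\<Gamma> z\<close>, that is,
  the double complement of \<open>ran_tilde H V z\<close>, which is closed.\<close>

lemma T_eq_zero_iff:
  assumes z: "z \<in> off_circle" and f: "f \<in> hcarrier H"
  shows "T f z = 0 \<longleftrightarrow> f \<in> ran_tilde H V z"
proof -
  have "T f z = 0 \<longleftrightarrow> (\<forall>i. hinner H f (\<Gamma> z (axis i 1)) = 0)"
    by (simp add: vec_eq_iff T_nth[OF z f])
  also have "\<dots> \<longleftrightarrow> (\<forall>u. hinner H f (\<Gamma> z u) = 0)"
  proof (intro iffI allI)
    fix u assume "\<forall>i. hinner H f (\<Gamma> z (axis i 1)) = 0"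
    then show "hinner H f (\<Gamma> z u) = 0"
      by (subst hinner_\<Gamma>[OF z f]) simp
  qed blast
  also have "\<dots> \<longleftrightarrow> f \<in> orth_compl H (\<Gamma> z ` UNIV)"
    using f by (auto simp: orth_compl_def)
  also have "orth_compl H (\<Gamma> z ` UNIV) = ran_tilde H V z"
    using \<Gamma>_bij[OF z] orth_compl_orth_compl[OF closed_subspace_ran_tilde[OF z]]
    by (simp add: bij_betw_def)
  finally show ?thesis .
qed

lemma inj_on_T: "inj_on T (hcarrier H)"
proof (rule inj_onI)
  fix f g
  assume f: "f \<in> hcarrier H" and g: "g \<in> hcarrier H" and eq: "T f = T g"
  have "f - g \<in> (\<Inter>z\<in>off_circle. ran_tilde H V z)"
    using T_eq_zero_iff[of _ "f - g"] f g eq by (auto simp: T_diff)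
  then show "f = g"
    using INT_ran_tilde[OF cnu] by simp
qed

section \<open>The model space as an isometric copy of \<open>H\<close>, and its operator\<close>

lemma hcarrier_M: "hcarrier M = T ` hcarrier H"
  and hscale_M: "hscale M = (\<lambda>c f z. c *s f z)"
  by (simp_all add: model_space_def)

lemma hinner_M:
  assumes "f \<in> hcarrier H" "g \<in> hcarrier H"
  shows "hinner M (T f) (T g) = hinner H f g"
  using assms by (simp add: model_space_def the_inv_into_f_f[OF inj_on_T])

lemma hnorm_M: "f \<in> hcarrier H \<Longrightarrow> hnorm M (T f) = hnorm H f"
  by (simp add: hnorm_def hinner_M)

lemma T_add_fun: "f \<in> hcarrier H \<Longrightarrow> g \<in> hcarrier H \<Longrightarrow> T (f + g) = T f + T g"
  by (rule ext) (simp add: T_add)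

lemma T_diff_fun: "f \<in> hcarrier H \<Longrightarrow> g \<in> hcarrier H \<Longrightarrow> T (f - g) = T f - T g"
  by (rule ext) (simp add: T_diff)

lemma hisometry_T: "hisometry H M T"
  unfolding hisometry_def hlinear_def
  by (auto simp: hcarrier_M hscale_M T_add_fun T_scale hnorm_M)

lemma hisometry_the_inv_into_T: "hisometry M H (the_inv_into (hcarrier H) T)"
  unfolding hisometry_def hlinear_def
  by (auto simp: hcarrier_M hscale_M T_add_fun[symmetric] T_scale[symmetric] hnorm_M
      the_inv_into_f_f[OF inj_on_T])

lemma orth_compl_M:
  assumes "S \<subseteq> hcarrier H"
  shows "orth_compl M (T ` S) = T ` orth_compl H S"
  using assms unfolding orth_compl_def hcarrier_M by (auto simp: hinner_M subset_iff)

text \<open>For initial \<open>f\<close> the vector \<open>V f - z f\<close> lies in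
  \<open>ran_tilde H V z\<close>, so its transform vanishes at \<open>z\<close>.\<close>

lemma T_V:
  assumes "f \<in> initial"
  shows "T (V f) = mult_z (T f)"
proof
  fix z
  have f: "f \<in> hcarrier H"
    using initial_carrier[OF assms] .
  show "T (V f) z = mult_z (T f) z"
  proof (cases "z \<in> off_circle")
    case True
    have "V f - hscale H z f \<in> ran_tilde H V z"
      using assms unfolding ran_tilde_def by blast
    then have "T (V f - hscale H z f) z = 0"
      using T_eq_zero_iff[OF True] f by simp
    then show ?thesis
      using f by (simp add: T_diff T_scale mult_z_def)
  qed (simp add: T_on_circle mult_z_def)
qed

text \<open>If \<open>mult_z (T f) = T g\<close>, the transform of \<open>g - z f\<close> vanishes
  at \<open>z\<close> for every \<open>z\<close> off the circle, and
  \<open>initial_if_ran_tilde\<close> applies. The converse is \<open>T_V\<close>.\<close>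

lemma mult_z_dom_M: "mult_z_dom M = T ` initial"
proof (intro equalityI subsetI)
  fix h assume "h \<in> mult_z_dom M"
  then obtain f g where f: "f \<in> hcarrier H" and g: "g \<in> hcarrier H"
    and h: "h = T f" "mult_z h = T g"
    unfolding mult_z_dom_def hcarrier_M by blast
  have "f \<in> initial"
  proof (rule initial_if_ran_tilde[OF f g])
    fix z assume z: "z \<in> off_circle"
    have "T g z = z *s T f z"
      using h unfolding mult_z_def by metis
    then show "g - hscale H z f \<in> ran_tilde H V z"
      using T_eq_zero_iff[OF z, of "g - hscale H z f"] f g by (simp add: T_diff T_scale)
  qed
  then show "h \<in> T ` initial"
    using h by blast
next
  fix h assume "h \<in> T ` initial"
  then obtain f where f: "f \<in> initial" and h: "h = T f" by blast
  then show "h \<in> mult_z_dom M"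
    unfolding mult_z_dom_def hcarrier_M using T_V[OF f, symmetric] initial_carrier[OF f] by simp
qed

text \<open>The projection is carried over from \<open>H\<close>. It is unique because two
  candidates \<open>T d\<close> and \<open>T e\<close> give a vector \<open>e - d\<close> in both
  \<open>initial\<close> and its complement.\<close>

lemma orth_proj_M:
  assumes f: "f \<in> hcarrier H" and d: "d \<in> initial" and fd: "f - d \<in> orth_compl H initial"
  shows "orth_proj M (mult_z_dom M) (T f) = T d"
  unfolding orth_proj_def mult_z_dom_M
proof (rule the_equality)
  have sub: "initial \<subseteq> hcarrier H"
    using initial_carrier by blast
  note dH = initial_carrier[OF d]
  show "T d \<in> T ` initial \<and> T f - T d \<in> orth_compl M (T ` initial)"
    using d fd f dH unfolding orth_compl_M[OF sub] by (auto simp: T_diff_fun[symmetric])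
  fix h assume h: "h \<in> T ` initial \<and> T f - h \<in> orth_compl M (T ` initial)"
  then obtain e where e: "e \<in> initial" "h = T e" by blast
  note eH = initial_carrier[OF e(1)]
  obtain w where w: "w \<in> orth_compl H initial" and Tw: "T (f - e) = T w"
    using h e f eH unfolding orth_compl_M[OF sub] by (auto simp: T_diff_fun)
  have "f - e = w"
    using inj_onD[OF inj_on_T Tw] w f eH by (simp add: orth_compl_def)
  then have "(f - d) - (f - e) \<in> orth_compl H initial"
    using w fd subspace_diff[OF subspace_orth_compl[OF sub]] by blast
  then have "hinner H (e - d) (e - d) = 0"
    using e(1) d subspace_diff[OF subspace_initial] by (auto simp: orth_compl_def)
  then have "e - d = 0"
    using hinner_definite[of "e - d"] eH dH by simp
  then show "h = T d"
    using e by simp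
qed

text \<open>Only the initial component \<open>d\<close> of \<open>f\<close> counts on either side:
  \<open>f - d\<close> lies in the double complement of the kernel, which is the kernel.\<close>

lemma model_op_T:
  assumes f: "f \<in> hcarrier H"
  shows "model_op M (T f) = T (V f)"
proof -
  obtain d where d: "d \<in> initial" and fd: "f - d \<in> orth_compl H initial"
    using orthogonal_decomposition[OF closed_subspace_initial f] .
  have "f - d \<in> hker H V"
    using fd orth_compl_orth_compl[OF closed_subspace_hker] by simp
  then have "V f = V d"
    using f initial_carrier[OF d] by (simp add: hker_def V_diff)
  then show ?thesis
    unfolding model_op_def orth_proj_M[OF f d fd] by (simp add: T_V[OF d])
qed

lemma hker_perp_M: "hker_perp M (model_op M) = mult_z_dom M"
proof -
  have "hker M (model_op M) = T ` hker H V"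
  proof -
    have "T (V f) = 0 \<longleftrightarrow> V f = 0" if "f \<in> hcarrier H" for f
      using inj_onD[OF inj_on_T, of "V f" 0] that T_diff_fun[of 0 0] by auto
    then show ?thesis
      using T_diff_fun[of 0 0] unfolding hker_def hcarrier_M by (auto simp: model_op_T)
  qed
  then show ?thesis
    using orth_compl_M[OF hker_subset] mult_z_dom_M by simp
qed

lemma model_op_mult_z_dom: "f \<in> mult_z_dom M \<Longrightarrow> model_op M f = mult_z f"
  unfolding mult_z_dom_M using model_op_T T_V initial_carrier by auto

text \<open>The intertwining isometry is \<open>T\<close>; its inverse serves for
  \<open>M_preceq\<close>.\<close>

lemma preceq_M: "preceq H V M (model_op M)"
  unfolding preceq_def hker_perp_M mult_z_dom_M
  using hisometry_T initial_carrier model_op_T by (intro exI[of _ T]) auto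

lemma M_preceq: "preceq M (model_op M) H V"
  unfolding preceq_def hker_perp_M mult_z_dom_M
  using hisometry_the_inv_into_T initial_carrier model_op_T
  by (intro exI[of _ "the_inv_into (hcarrier H) T"]) (auto simp: the_inv_into_f_f[OF inj_on_T])

section \<open>Surjectivity and analyticity of point evaluations\<close>

text \<open>The Gram matrix of the vectors \<open>\<Gamma> z (axis i 1)\<close> is invertible.\<close>

lemma T_surj:
  assumes z: "z \<in> off_circle"
  obtains f where "f \<in> hcarrier H" "T f z = u"
proof -
  define G where "G = (\<chi> i j. hinner H (\<Gamma> z (axis j 1)) (\<Gamma> z (axis i 1)))"
  have G: "T (\<Gamma> z u) z = G *v u" for u
  proof -
    have "\<Gamma> z u = (\<Sum>j\<in>UNIV. hscale H (u $ j) (\<Gamma> z (axis j 1)))"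
      using \<Gamma>_sum[OF z, of "\<lambda>i. u $ i *s axis i 1" UNIV]
      by (simp add: basis_expansion \<Gamma>_scale[OF z])
    then show ?thesis
      using \<Gamma>_carrier[OF z] z
      by (simp add: T_sum T_scale vec_eq_iff T_nth G_def matrix_vector_mult_def mult.commute)
  qed
  \<comment> \<open>A kernel vector of \<open>G\<close> puts \<open>\<Gamma> z u\<close> both in
    \<open>ran_tilde H V z\<close> and in its complement, so it is 0, and \<open>\<Gamma> z\<close>
    is injective.\<close>
  have "u = 0" if "G *v u = 0" for u
  proof -
    have "\<Gamma> z u \<in> ran_tilde H V z"
      using that G T_eq_zero_iff[OF z \<Gamma>_carrier[OF z]] by simp
    moreover have "\<Gamma> z u \<in> orth_compl H (ran_tilde H V z)"
      using \<Gamma>_bij[OF z] by (auto simp: bij_betw_def)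
    ultimately have "hinner H (\<Gamma> z u) (\<Gamma> z u) = 0"
      by (simp add: orth_compl_def)
    then have "\<Gamma> z u = \<Gamma> z 0"
      using hinner_definite[OF \<Gamma>_carrier[OF z]] \<Gamma>_zero[OF z] by simp
    then show ?thesis
      using \<Gamma>_bij[OF z] by (auto simp: bij_betw_def dest: injD)
  qed
  then obtain L where "L ** G = mat 1"
    using matrix_left_invertible_ker[of G] by blast
  then have "G ** L = mat 1"
    using matrix_left_right_inverse by blast
  then have "T (\<Gamma> z (L *v u)) z = u"
    by (simp add: G matrix_vector_mul_assoc)
  then show thesis
    using that \<Gamma>_carrier[OF z] by blast
qed

text \<open>The inner product is conjugate linear in its second argument, which turns the
  anti-analytic \<open>\<Gamma>\<close> into an analytic function. Cauchy-Schwarz bounds the error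
  of the difference quotient by an operator norm.\<close>

lemma T_holomorphic:
  assumes f: "f \<in> hcarrier H"
  shows "(\<lambda>z. T f z $ i) holomorphic_on off_circle"
proof -
  define g where "g z = hinner H f (\<Gamma> z (axis i 1))" for z
  have "\<exists>g'. (g has_field_derivative g') (at z within off_circle)" if z: "z \<in> off_circle" for z
  proof -
    \<comment> \<open>The error of the conjugate difference quotient against the derivative
      \<open>D\<close>.\<close>
    define Q where "Q D w = (\<lambda>x. hscale H (1 / cnj (w - z)) (\<Gamma> w x - \<Gamma> z x) - D x)" for D w
    obtain D where D: "hbounded cvec_space H D"
      and lim: "((\<lambda>w. hopnorm cvec_space H (Q D w)) \<longlongrightarrow> 0) (at z within off_circle)"
      using \<Gamma>_anti_analytic z unfolding anti_analytic_on_def Q_def by blast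
    have DH: "D x \<in> hcarrier H" for x
      using D unfolding hbounded_def hlinear_def by auto
    have cvec_nonneg: "hnorm cvec_space x \<ge> 0" for x :: "complex ^ 'n"
      by (simp add: hnorm_def sum_nonneg)
    have le: "cmod ((g w - g z) / (w - z) - hinner H f (D (axis i 1)))
        \<le> hnorm H f * hopnorm cvec_space H (Q D w)" if w: "w \<in> off_circle" for w
    proof -
      obtain C1 where C1: "\<And>x. hnorm H (\<Gamma> w x) \<le> C1 * hnorm cvec_space x"
        using \<Gamma>_bounded[OF w] unfolding hbounded_def by auto
      obtain C2 where C2: "\<And>x. hnorm H (\<Gamma> z x) \<le> C2 * hnorm cvec_space x"
        using \<Gamma>_bounded[OF z] unfolding hbounded_def by auto
      obtain C3 where C3: "\<And>x. hnorm H (D x) \<le> C3 * hnorm cvec_space x"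
        using D unfolding hbounded_def by auto
      define c where "c = 1 / cnj (w - z)"
      have QH: "Q D w x \<in> hcarrier H" for x
        using \<Gamma>_carrier w z DH unfolding Q_def by simp
      \<comment> \<open>Some bound, possibly depending on \<open>w\<close>, is required for
        \<open>hopnorm\<close> to dominate the value at \<open>axis i 1\<close>.\<close>
      have Q_bdd: "hnorm H (Q D w x) \<le> (cmod c * (C1 + C2) + C3) * hnorm cvec_space x" for x
      proof -
        have "hnorm H (Q D w x) \<le> cmod c * hnorm H (\<Gamma> w x - \<Gamma> z x) + hnorm H (D x)"
          using hnorm_triangle_ineq4[of "hscale H c (\<Gamma> w x - \<Gamma> z x)" "D x"] \<Gamma>_carrier w z DH
          unfolding Q_def c_def by (simp only: hnorm_scale hcarrier_diff hcarrier_scale)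
        also have "\<dots> \<le> cmod c * ((C1 + C2) * hnorm cvec_space x) + C3 * hnorm cvec_space x"
        proof (intro add_mono mult_left_mono)
          show "hnorm H (\<Gamma> w x - \<Gamma> z x) \<le> (C1 + C2) * hnorm cvec_space x"
            using hnorm_triangle_ineq4[OF \<Gamma>_carrier[OF w, of x] \<Gamma>_carrier[OF z, of x]] C1[of x] C2[of x]
            by (simp add: distrib_right)
        qed (use C3 in auto)
        finally show ?thesis
          by (simp add: algebra_simps)
      qed
      have "(g w - g z) / (w - z) - hinner H f (D (axis i 1)) = hinner H f (Q D w (axis i 1))"
        using f \<Gamma>_carrier[OF w] \<Gamma>_carrier[OF z] DH unfolding g_def Q_def
        by (simp add: hinner_diff_right hinner_scale_right)
      also have "cmod \<dots> \<le> hnorm H f * hnorm H (Q D w (axis i 1))"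
        using Cauchy_Schwarz[OF f QH] .
      also have "\<dots> \<le> hnorm H f * hopnorm cvec_space H (Q D w)"
        using f hnorm_le_hopnorm[of cvec_space H "Q D w", OF cvec_nonneg Q_bdd]
        by (intro mult_left_mono) (simp_all add: hnorm_cvec_space_axis)
      finally show ?thesis .
    qed
    have "((\<lambda>w. (g w - g z) / (w - z) - hinner H f (D (axis i 1))) \<longlongrightarrow> 0) (at z within off_circle)"
    proof (rule Lim_null_comparison)
      show "((\<lambda>w. hnorm H f * hopnorm cvec_space H (Q D w)) \<longlongrightarrow> 0) (at z within off_circle)"
        using tendsto_mult_right_zero[OF lim] .
      show "\<forall>\<^sub>F w in at z within off_circle.
          cmod ((g w - g z) / (w - z) - hinner H f (D (axis i 1))) \<le> hnorm H f * hopnorm cvec_space H (Q D w)"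
        using le by (auto simp: eventually_at_filter)
    qed
    then show ?thesis
      unfolding has_field_derivative_iff using Lim_null by blast
  qed
  then have "g holomorphic_on off_circle"
    unfolding holomorphic_on_def field_differentiable_def by blast
  then show ?thesis
    by (rule holomorphic_transform) (simp add: T_nth f g_def)
qed

end

section \<open>Multipliers\<close>

text \<open>The matrix \<open>R z\<close> commutes with the scalar \<open>z\<close>, so
  multiplication by \<open>R\<close> respects the domains of \<open>mult_z\<close>, which are the
  initial spaces by \<open>hker_perp_M\<close>.\<close>

lemma preceq_if_isometric_multiplier:
  assumes "cnu_model HA A \<Gamma>A" "cnu_model HB B \<Gamma>B"
    and R: "isometric_multiplier (model_space HA \<Gamma>A) (model_space HB \<Gamma>B) R"
  shows "preceq (model_space HA \<Gamma>A) (model_op (model_space HA \<Gamma>A))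
                (model_space HB \<Gamma>B) (model_op (model_space HB \<Gamma>B))"
proof -
  interpret A: cnu_model HA A \<Gamma>A by fact
  interpret B: cnu_model HB B \<Gamma>B by fact
  define U where "U f = (\<lambda>z. R z *v f z)" for f
  have U: "U f \<in> hcarrier B.M" "hnorm B.M (U f) = hnorm A.M f" if "f \<in> hcarrier A.M" for f
    using R that unfolding isometric_multiplier_def U_def by blast+
  have U_mult_z: "U (mult_z f) = mult_z (U f)" for f
    unfolding U_def mult_z_def by (simp add: vector_scalar_commute)
  have iso: "hisometry A.M B.M U"
    unfolding hisometry_def hlinear_def A.hscale_M B.hscale_M
    using U by (auto simp: U_def fun_eq_iff matrix_vector_right_distrib vector_scalar_commute)
  have dom: "U f \<in> mult_z_dom B.M" if "f \<in> mult_z_dom A.M" for f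
    using that U(1) U_mult_z[symmetric] unfolding mult_z_dom_def by simp
  have "U (model_op A.M f) = model_op B.M (U f)" if "f \<in> mult_z_dom A.M" for f
    using dom[OF that] that
    by (simp add: A.model_op_mult_z_dom B.model_op_mult_z_dom U_mult_z)
  then show ?thesis
    unfolding preceq_def A.hker_perp_M B.hker_perp_M using iso dom by blast
qed

section \<open>From the order relation to a multiplier\<close>

text \<open>The columns of \<open>R z\<close> come from vectors chosen separately for each
  \<open>z\<close>. Analyticity is therefore proved afterwards, by solving a linear system with
  analytic coefficients near each point.\<close>

lemma isometric_multiplier_if_preceq:
  fixes \<Gamma>A :: "complex \<Rightarrow> complex ^ 'n \<Rightarrow> 'a::ab_group_add"
    and \<Gamma>B :: "complex \<Rightarrow> complex ^ 'n \<Rightarrow> 'b::ab_group_add"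
  assumes "cnu_model HA A \<Gamma>A" "cnu_model HB B \<Gamma>B" and "preceq HA A HB B"
  shows "\<exists>R. isometric_multiplier (model_space HA \<Gamma>A) (model_space HB \<Gamma>B) R"
proof -
  interpret A: cnu_model HA A \<Gamma>A by fact
  interpret B: cnu_model HB B \<Gamma>B by fact
  obtain U where iso: "hisometry HA HB U" and U_init: "U ` A.initial \<subseteq> B.initial"
    and U_A: "\<forall>x\<in>A.initial. U (A x) = B (U x)"
    using assms(3) unfolding preceq_def by blast
  have U_H: "U x \<in> hcarrier HB" if "x \<in> hcarrier HA" for x
    using iso that unfolding hisometry_def hlinear_def by blast
  have U_add: "U (x + y) = U x + U y" if "x \<in> hcarrier HA" "y \<in> hcarrier HA" for x y
    using iso that unfolding hisometry_def hlinear_def by blast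
  have U_scale: "U (hscale HA c x) = hscale HB c (U x)" if "x \<in> hcarrier HA" for c x
    using iso that unfolding hisometry_def hlinear_def by blast
  have U_diff: "U (x - y) = U x - U y" if "x \<in> hcarrier HA" "y \<in> hcarrier HA" for x y
    using U_add[of "x - y" y] that by simp
  have U_sum: "U (\<Sum>i\<in>I. x i) = (\<Sum>i\<in>I. U (x i))" if "\<And>i. x i \<in> hcarrier HA" for x and I :: "'n set"
    using that U_diff[of 0 0]
    by (induction I rule: infinite_finite_induct) (simp_all add: U_add A.hcarrier_sum)
  have U_zero: "B.T (U f) z = 0" if f: "f \<in> hcarrier HA" and z: "z \<in> off_circle" and T: "A.T f z = 0" for f z
  proof -
    obtain x where x: "x \<in> A.initial" "f = A x - hscale HA z x"
      using A.T_eq_zero_iff[OF z f] T unfolding ran_tilde_def by blast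
    note xH = A.initial_carrier[OF x(1)]
    have "U f = B (U x) - hscale HB z (U x)"
      using x xH U_A by (simp add: U_diff U_scale)
    moreover have "U x \<in> B.initial"
      using x(1) U_init by blast
    ultimately have "U f \<in> ran_tilde HB B z"
      unfolding ran_tilde_def by blast
    then show ?thesis
      using B.T_eq_zero_iff[OF z U_H[OF f]] by simp
  qed
  \<comment> \<open>The guard inside the existential lets the choice run over all \<open>z\<close>;
    on the circle the vector 0 serves.\<close>
  have "\<exists>f\<in>hcarrier HA. z \<in> off_circle \<longrightarrow> A.T f z = axis j 1" for z j
    using A.T_surj[of z] A.hcarrier_zero by metis
  then obtain F where FH: "\<And>z j. F z j \<in> hcarrier HA"
    and F: "\<And>z j. z \<in> off_circle \<Longrightarrow> A.T (F z j) z = axis j 1"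
    by metis
  define R :: "complex \<Rightarrow> complex ^ 'n ^ 'n" where "R z = (\<chi> i j. B.T (U (F z j)) z $ i)" for z
  have R: "R z *v A.T f z = B.T (U f) z" if f: "f \<in> hcarrier HA" for f z
  proof (cases "z \<in> off_circle")
    case z: True
    \<comment> \<open>A combination of the chosen vectors with the same transform as
      \<open>f\<close> at \<open>z\<close>, so \<open>U_zero\<close> applies to
      \<open>f - h\<close>.\<close>
    define h where "h = (\<Sum>j\<in>UNIV. hscale HA (A.T f z $ j) (F z j))"
    have hH: "h \<in> hcarrier HA"
      unfolding h_def by (simp add: A.hcarrier_sum FH)
    have "A.T h z = (\<Sum>j\<in>UNIV. A.T f z $ j *s axis j 1)"
      unfolding h_def by (simp add: A.T_sum A.T_scale FH F[OF z])
    then have "A.T (f - h) z = 0"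
      using f hH by (simp add: A.T_diff basis_expansion)
    then have "B.T (U (f - h)) z = 0"
      using U_zero[of "f - h" z] f hH z by simp
    then have "B.T (U f) z = B.T (U h) z"
      using f hH U_H by (simp add: U_diff B.T_diff)
    also have "\<dots> = (\<Sum>j\<in>UNIV. A.T f z $ j *s B.T (U (F z j)) z)"
      unfolding h_def by (simp add: U_sum U_scale FH B.T_sum B.T_scale U_H)
    also have "\<dots> = R z *v A.T f z"
      by (simp add: vec_eq_iff R_def matrix_vector_mult_def mult.commute)
    finally show ?thesis by simp
  next
    case False
    then show ?thesis
      unfolding A.T_on_circle[OF False] B.T_on_circle[OF False] by simp
  qed
  have hol: "(\<lambda>z. R z $ i $ k) holomorphic_on off_circle" for i k
  proof -
    have "(\<lambda>z. R z $ i $ k) field_differentiable at z0" if z0: "z0 \<in> off_circle" for z0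
    proof -
      \<comment> \<open>The vectors chosen for \<open>z0\<close> are now kept while \<open>z\<close>
        varies. Row \<open>i\<close> of \<open>R z\<close> then solves the system with matrix
        \<open>P z\<close> and right-hand side \<open>q z\<close>, both analytic in
        \<open>z\<close>.\<close>
      define f where "f j = F z0 j" for j
      have fH: "f j \<in> hcarrier HA" for j
        unfolding f_def by (rule FH)
      define P :: "complex \<Rightarrow> complex ^ 'n ^ 'n" where "P z = (\<chi> j l. A.T (f j) z $ l)" for z
      define q where "q z = (\<chi> j. B.T (U (f j)) z $ i)" for z
      \<comment> \<open>The numerator in Cramer's rule: column \<open>k\<close> of
        \<open>P z\<close> is replaced by \<open>q z\<close>.\<close>
      define N where "N k z = det (\<chi> j l. if l = k then q z $ j else P z $ j $ l)" for k z
      have entries: "(\<lambda>z. P z $ j $ l) holomorphic_on off_circle" "(\<lambda>z. q z $ j) holomorphic_on off_circle" for j l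
        using A.T_holomorphic[OF fH] B.T_holomorphic[OF U_H[OF fH]] unfolding P_def q_def by simp_all
      have det_hol: "(\<lambda>z. det (P z)) holomorphic_on off_circle"
        unfolding det_def by (intro holomorphic_intros entries)
      have N_hol: "(\<lambda>z. N k z) holomorphic_on off_circle"
        unfolding N_def det_def
      proof (intro holomorphic_intros)
        fix p j
        show "(\<lambda>z. (\<chi> j l. if l = k then q z $ j else P z $ j $ l) $ j $ p j) holomorphic_on off_circle"
          using entries by (cases "p j = k") simp_all
      qed
      \<comment> \<open>The open set where the system is uniquely solvable; it contains
        \<open>z0\<close> because \<open>P z0\<close> is the identity matrix.\<close>
      define X where "X = off_circle \<inter> {z. det (P z) \<noteq> 0}"
      have "open off_circle"
        by (simp add: open_Compl)
      then have "open (off_circle \<inter> (\<lambda>z. det (P z)) -` (- {0}))"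
        by (intro continuous_open_preimage holomorphic_on_imp_continuous_on[OF det_hol])
          (simp_all add: open_Compl)
      then have "open X"
        unfolding X_def by (simp add: vimage_def)
      have "P z0 = mat 1"
        unfolding P_def f_def F[OF z0] by (auto simp: vec_eq_iff mat_def axis_def)
      then have "z0 \<in> X"
        unfolding X_def using z0 by simp
      have solve: "R z $ i $ k = N k z / det (P z)" if "z \<in> X" for z
      proof -
        have "P z *v (R z $ i) = q z"
          using R[OF fH, of z] unfolding P_def q_def
          by (simp add: vec_eq_iff matrix_vector_mult_def mult.commute)
        then have "R z $ i = (\<chi> k. N k z / det (P z))"
          using cramer[of "P z" "R z $ i" "q z"] that unfolding X_def N_def by simp
        then show ?thesis
          by simp
      qed
      have "(\<lambda>z. N k z / det (P z)) holomorphic_on X"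
        by (intro holomorphic_on_divide holomorphic_on_subset[OF N_hol] holomorphic_on_subset[OF det_hol])
          (auto simp: X_def)
      then have "(\<lambda>z. R z $ i $ k) holomorphic_on X"
        by (rule holomorphic_transform) (simp add: solve)
      then show ?thesis
        using \<open>open X\<close> \<open>z0 \<in> X\<close> holomorphic_on_imp_differentiable_at by blast
    qed
    then show ?thesis
      unfolding holomorphic_on_def by (blast intro: field_differentiable_at_within)
  qed
  have "(\<lambda>z. R z *v h z) \<in> hcarrier B.M \<and> hnorm B.M (\<lambda>z. R z *v h z) = hnorm A.M h"
    if h: "h \<in> hcarrier A.M" for h
  proof -
    obtain f where f: "f \<in> hcarrier HA" "h = A.T f"
      using h unfolding A.hcarrier_M by blast
    have "(\<lambda>z. R z *v h z) = B.T (U f)"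
      using R f by auto
    moreover have "hnorm HB (U f) = hnorm HA f"
      using iso f unfolding hisometry_def by blast
    ultimately show ?thesis
      using f U_H by (simp add: B.hcarrier_M A.hnorm_M B.hnorm_M)
  qed
  then show ?thesis
    unfolding isometric_multiplier_def using hol by blast
qed

theorem theorem8p2:
  fixes HA :: "'a::ab_group_add hspace" and HB :: "'b::ab_group_add hspace"
    and A :: "'a \<Rightarrow> 'a" and B :: "'b \<Rightarrow> 'b"
    and \<Gamma>A :: "complex \<Rightarrow> complex ^ 'n \<Rightarrow> 'a"
    and \<Gamma>B :: "complex \<Rightarrow> complex ^ 'n \<Rightarrow> 'b"
  assumes "complex_hilbert_space HA" and "complex_hilbert_space HB"
    and "A \<in> cnu_partial_isometries CARD('n) HA"
    and "B \<in> cnu_partial_isometries CARD('n) HB"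
    and "is_model HA A \<Gamma>A" and "is_model HB B \<Gamma>B"
  shows "(preceq HA A HB B \<longleftrightarrow>
            preceq (model_space HA \<Gamma>A) (model_op (model_space HA \<Gamma>A))
                   (model_space HB \<Gamma>B) (model_op (model_space HB \<Gamma>B))) \<and>
         (preceq (model_space HA \<Gamma>A) (model_op (model_space HA \<Gamma>A))
                 (model_space HB \<Gamma>B) (model_op (model_space HB \<Gamma>B)) \<longleftrightarrow>
            (\<exists>R. isometric_multiplier (model_space HA \<Gamma>A) (model_space HB \<Gamma>B) R))"
proof -
  have A: "cnu_model HA A \<Gamma>A" and B: "cnu_model HB B \<Gamma>B"
    using assms
    by (simp_all add: cnu_partial_isometries_def cnu_model_def cnu_model_axioms_def
        hilbert_partial_isometry_def hilbert_partial_isometry_axioms_def)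
  \<comment> \<open>Each operator and its model precede one another, so transitivity moves the
    relation in both directions.\<close>
  have iff: "preceq HA A HB B \<longleftrightarrow>
      preceq (model_space HA \<Gamma>A) (model_op (model_space HA \<Gamma>A))
             (model_space HB \<Gamma>B) (model_op (model_space HB \<Gamma>B))"
    using cnu_model.preceq_M[OF A] cnu_model.M_preceq[OF A]
      cnu_model.preceq_M[OF B] cnu_model.M_preceq[OF B]
    by (blast intro: preceq_trans)
  then show ?thesis
    using preceq_if_isometric_multiplier[OF A B] isometric_multiplier_if_preceq[OF A B] by blast
qed

end
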